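(* Let $n\ge1$ and fix a nonzero homogeneous polynomial $T\in S^4\mathbb{C}^{n+1}$ for which there exists a finite set $A\subset\mathbb{P}^n$ that computes $T$, is minimal for $T$, has cardinality $\ell(A)=2n+1$, and is contained in a rational normal curve $\Gamma\subset\mathbb{P}^n$. Then there exists a positive-dimensional family of finite sets $A_t\subset\Gamma$ such that (i) $\ell(A_t)=2n+1$ for all $t$; (ii) $A_0=A$ for some parameter value $0$; (iii) $T\in\langle\nu_4(A_t)\rangle$ for all $t$, i.e. each $A_t$ computes $T$.
   Context: $\mathbb{P}^n=\mathbb{P}^n_{\mathbb{C}}$; $S^4\mathbb{C}^{n+1}$ is the space of degree-4 forms in $n+1$ variables over $\mathbb{C}$, and a nonzero $T$ is identified with the point it defines in $\mathbb{P}(S^4\mathbb{C}^{n+1})$. $\nu_4:\mathbb{P}^n\to\mathbb{P}^N$, $N=\binom{n+4}{4}-1$, is the degree-4 Veronese embedding (sending the class of a linear form to the class of its fourth power). $\ell(A)$ is the cardinality of a finite set $A$. A finite set $A\subset\mathbb{P}^n$ computes $T$ if $T\in\langle\nu_4(A)\rangle$, the linear span of $\nu_4(A)$. A set $A$ computing $T$ is minimal for $T$ if there is no proper subset $A'\subsetneq A$ with $T\in\langle\nu_4(A')\rangle$. A rational normal curve in $\mathbb{P}^n$ is a curve which, up to a projective linear automorphism of $\mathbb{P}^n$, is the image of the degree-$n$ Veronese embedding of $\mathbb{P}^1$. "Positive-dimensional family of finite sets $A_t\subset\Gamma$" with $\ell(A_t)=2n+1$ means: an irreducible locally closed subvariety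 of dimension at least $1$ of the symmetric product $\mathrm{Sym}^{2n+1}(\Gamma)$, all of whose points $t$ correspond to sets $A_t$ of $2n+1$ distinct points of $\Gamma$; condition (ii) says that the point corresponding to $A$ belongs to this subvariety. *)

theory Defs
  imports
    "HOL-Analysis.Abstract_Topology"
    "HOL-Library.Poly_Mapping"
    "HOL-Library.Multiset"
    "HOL-Library.Extended_Nat"
    "Jordan_Normal_Form.Matrix"
begin

section \<open>Polynomials and forms over the complex numbers\<close>

text \<open>Multivariate polynomials with variables in \<open>'v\<close>: finitely supported maps from
  exponent vectors to coefficients.  The ring structure is that of \<open>Poly_Mapping\<close>.\<close>

type_synonym 'v cpoly = "('v \<Rightarrow>\<^sub>0 nat) \<Rightarrow>\<^sub>0 complex"

definition scale_poly :: "complex \<Rightarrow> 'v cpoly \<Rightarrow> 'v cpoly" where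
  "scale_poly c p = Poly_Mapping.single 0 c * p"

interpretation cpoly: vector_space scale_poly
proof
  fix a b :: complex and x y :: "'v cpoly"
  show "scale_poly a (x + y) = scale_poly a x + scale_poly a y"
    by (simp add: scale_poly_def distrib_left)
  show "scale_poly (a + b) x = scale_poly a x + scale_poly b x"
    by (simp add: scale_poly_def single_add distrib_right)
  show "scale_poly a (scale_poly b x) = scale_poly (a * b) x"
    by (simp add: scale_poly_def mult_single flip: mult.assoc)
  show "scale_poly 1 x = x"
    by (simp add: scale_poly_def)
qed

definition forms :: "nat \<Rightarrow> nat \<Rightarrow> nat cpoly set" where
  \<comment> \<open>forms of degree \<open>d\<close> in the \<open>n + 1\<close> variables with indices \<open>0, \<dots>, n\<close>\<close>
  "forms d n = {p. \<forall>\<mu>\<in>Poly_Mapping.keys p.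
      Poly_Mapping.keys \<mu> \<subseteq> {..n} \<and> (\<Sum>j\<le>n. Poly_Mapping.lookup \<mu> j) = d}"

definition poly_eval :: "('v \<Rightarrow> complex) \<Rightarrow> 'v cpoly \<Rightarrow> complex" where
  "poly_eval x p = (\<Sum>\<mu>\<in>Poly_Mapping.keys p.
      Poly_Mapping.lookup p \<mu> * (\<Prod>v\<in>Poly_Mapping.keys \<mu>. x v ^ Poly_Mapping.lookup \<mu> v))"

section \<open>Projective space, Veronese embeddings, rational normal curves\<close>

text \<open>A point of projective space is a one-dimensional linear subspace (zero vector included),
  so that the linear span of a set of points is the span of its union.\<close>

definition proj_point :: "complex vec \<Rightarrow> complex vec set" where
  "proj_point v = {c \<cdot>\<^sub>v v | c. True}"

definition proj_space :: "nat \<Rightarrow> complex vec set set" where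
  "proj_space n = proj_point ` (carrier_vec (n + 1) - {0\<^sub>v (n + 1)})"

definition linear_form :: "complex vec \<Rightarrow> nat cpoly" where
  "linear_form v = (\<Sum>j<dim_vec v. Poly_Mapping.single (Poly_Mapping.single j 1) (v $ j))"

definition veronese :: "nat \<Rightarrow> complex vec set \<Rightarrow> nat cpoly set" where
  \<comment> \<open>the line spanned by \<open>L ^ d\<close>, for the point given by the class of the linear form \<open>L\<close>\<close>
  "veronese d P = {scale_poly c (linear_form v ^ d) | c v. v \<in> P}"

definition computes :: "nat \<Rightarrow> nat cpoly \<Rightarrow> complex vec set set \<Rightarrow> bool" where
  "computes n T A \<longleftrightarrow>
     finite A \<and> A \<subseteq> proj_space n \<and> T \<in> cpoly.span (\<Union>P\<in>A. veronese 4 P)"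

definition minimally_computes :: "nat \<Rightarrow> nat cpoly \<Rightarrow> complex vec set set \<Rightarrow> bool" where
  "minimally_computes n T A \<longleftrightarrow> computes n T A \<and> (\<forall>A'. A' \<subset> A \<longrightarrow> \<not> computes n T A')"

definition standard_rational_normal_curve :: "nat \<Rightarrow> complex vec set set" where
  "standard_rational_normal_curve n =
     {proj_point (vec (n + 1) (\<lambda>i. s ^ (n - i) * t ^ i)) | s t. (s, t) \<noteq> (0, 0)}"

definition rational_normal_curve :: "nat \<Rightarrow> complex vec set set \<Rightarrow> bool" where
  "rational_normal_curve n \<Gamma> \<longleftrightarrow>
     (\<exists>M \<in> carrier_mat (n + 1) (n + 1). invertible_mat M \<and>
        \<Gamma> = (\<lambda>P. (\<lambda>v. M *\<^sub>v v) ` P) ` standard_rational_normal_curve n)"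

section \<open>Irreducibility, local closedness, dimension\<close>

definition irreducible_space :: "'a topology \<Rightarrow> bool" where
  "irreducible_space X \<longleftrightarrow> topspace X \<noteq> {} \<and>
     (\<forall>C D. closedin X C \<and> closedin X D \<and> C \<union> D = topspace X \<longrightarrow>
        C = topspace X \<or> D = topspace X)"

definition locally_closed_in :: "'a topology \<Rightarrow> 'a set \<Rightarrow> bool" where
  "locally_closed_in X S \<longleftrightarrow> (\<exists>U C. openin X U \<and> closedin X C \<and> S = U \<inter> C)"

text \<open>Krull dimension: supremum of the lengths of chains of irreducible closed subsets.
  The empty space gets dimension 0.\<close>

definition krull_dim :: "'a topology \<Rightarrow> enat" where
  "krull_dim X = Sup {enat k | k. \<exists>Z :: nat \<Rightarrow> 'a set.
     (\<forall>i\<le>k. closedin X (Z i) \<and> irreducible_space (subtopology X (Z i))) \<and>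
     (\<forall>i<k. Z i \<subset> Z (Suc i))}"

section \<open>The Zariski topology on products and symmetric products\<close>

text \<open>Points of the \<open>m\<close>-fold product of projective \<open>n\<close>-space are lists of length \<open>m\<close>.  The
  variable \<open>(i, j)\<close> is the \<open>j\<close>-th homogeneous coordinate on the \<open>i\<close>-th factor; closed sets are
  the common zero loci of polynomials homogeneous in each group of variables separately.\<close>

definition proj_tuples :: "nat \<Rightarrow> nat \<Rightarrow> complex vec set list set" where
  "proj_tuples n m = {xs. length xs = m \<and> set xs \<subseteq> proj_space n}"

definition multiforms :: "nat \<Rightarrow> nat \<Rightarrow> (nat \<times> nat) cpoly set" where
  "multiforms n m = {p. \<exists>d :: nat \<Rightarrow> nat. \<forall>\<mu>\<in>Poly_Mapping.keys p.
      Poly_Mapping.keys \<mu> \<subseteq> {..<m} \<times> {..n} \<and>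
      (\<forall>i<m. (\<Sum>j\<le>n. Poly_Mapping.lookup \<mu> (i, j)) = d i)}"

text \<open>\<open>r\<close> ranges over all choices of homogeneous coordinates of the points in \<open>xs\<close>; for
  multihomogeneous \<open>p\<close> the choice does not matter.\<close>

definition vanishes_at :: "nat \<Rightarrow> (nat \<times> nat) cpoly \<Rightarrow> complex vec set list \<Rightarrow> bool" where
  "vanishes_at n p xs \<longleftrightarrow>
     (\<forall>r. (\<forall>i<length xs. r i \<in> xs ! i - {0\<^sub>v (n + 1)}) \<longrightarrow> poly_eval (\<lambda>(i, j). r i $ j) p = 0)"

definition zero_locus :: "nat \<Rightarrow> nat \<Rightarrow> (nat \<times> nat) cpoly set \<Rightarrow> complex vec set list set" where
  "zero_locus n m S = {xs \<in> proj_tuples n m. \<forall>p\<in>S. vanishes_at n p xs}"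

definition zariski_product :: "nat \<Rightarrow> nat \<Rightarrow> complex vec set list topology" where
  "zariski_product n m = topology (\<lambda>U. U \<subseteq> proj_tuples n m \<and>
     (\<exists>S \<subseteq> multiforms n m. proj_tuples n m - U = zero_locus n m S))"

definition quotient_topology :: "'a topology \<Rightarrow> ('a \<Rightarrow> 'b) \<Rightarrow> 'b topology" where
  "quotient_topology X f = topology (\<lambda>U. U \<subseteq> f ` topspace X \<and> openin X {x \<in> topspace X. f x \<in> U})"

text \<open>The points of the symmetric product are the multisets of size \<open>m\<close> with elements in
  \<open>\<Gamma>\<close>; its topology is the quotient topology from the \<open>m\<close>-fold product of \<open>\<Gamma>\<close> with itself.\<close>

definition sym_product :: "nat \<Rightarrow> nat \<Rightarrow> complex vec set set \<Rightarrow> complex vec set multiset topology" where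
  "sym_product n m \<Gamma> =
     quotient_topology (subtopology (zariski_product n m) {xs. length xs = m \<and> set xs \<subseteq> \<Gamma>}) mset"

text \<open>\<open>F\<close> is the set of all members of the family; sets of \<open>m\<close> distinct points are identified
  with the corresponding reduced points of the symmetric product.\<close>

definition positive_dimensional_family ::
    "nat \<Rightarrow> nat \<Rightarrow> complex vec set set \<Rightarrow> complex vec set set set \<Rightarrow> bool" where
  "positive_dimensional_family n m \<Gamma> F \<longleftrightarrow>
     (\<forall>B\<in>F. finite B \<and> B \<subseteq> \<Gamma> \<and> card B = m) \<and>
     locally_closed_in (sym_product n m \<Gamma>) (mset_set ` F) \<and>
     irreducible_space (subtopology (sym_product n m \<Gamma>) (mset_set ` F)) \<and>
     krull_dim (subtopology (sym_product n m \<Gamma>) (mset_set ` F)) \<ge> 1"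

section \<open>The collections of open sets above are topologies\<close>

definition mono_eval :: "('v \<Rightarrow> complex) \<Rightarrow> ('v \<Rightarrow>\<^sub>0 nat) \<Rightarrow> complex" where
  "mono_eval x \<mu> = (\<Prod>v\<in>Poly_Mapping.keys \<mu>. x v ^ Poly_Mapping.lookup \<mu> v)"

lemma mono_eval_superset:
  assumes "finite K" "Poly_Mapping.keys \<mu> \<subseteq> K"
  shows "mono_eval x \<mu> = (\<Prod>v\<in>K. x v ^ Poly_Mapping.lookup \<mu> v)"
  unfolding mono_eval_def
  by (rule prod.mono_neutral_left) (use assms in \<open>auto simp: in_keys_iff\<close>)

lemma mono_eval_add: "mono_eval x (\<mu> + \<nu>) = mono_eval x \<mu> * mono_eval x \<nu>"
proof -
  let ?K = "Poly_Mapping.keys \<mu> \<union> Poly_Mapping.keys \<nu>"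
  have "Poly_Mapping.keys (\<mu> + \<nu>) \<subseteq> ?K" by (rule Poly_Mapping.keys_add)
  then show ?thesis
    by (simp add: mono_eval_superset[where K = ?K] lookup_add power_add prod.distrib)
qed

lemma poly_eval_superset:
  assumes "finite K" "Poly_Mapping.keys p \<subseteq> K"
  shows "poly_eval x p = (\<Sum>\<mu>\<in>K. Poly_Mapping.lookup p \<mu> * mono_eval x \<mu>)"
  unfolding poly_eval_def mono_eval_def
  by (rule sum.mono_neutral_left) (use assms in \<open>auto simp: in_keys_iff\<close>)

lemma poly_eval_add: "poly_eval x (p + q) = poly_eval x p + poly_eval x q"
proof -
  let ?K = "Poly_Mapping.keys p \<union> Poly_Mapping.keys q"
  have "Poly_Mapping.keys (p + q) \<subseteq> ?K" by (rule Poly_Mapping.keys_add)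
  then show ?thesis
    by (simp add: poly_eval_superset[where K = ?K] lookup_add distrib_right sum.distrib)
qed

lemma poly_eval_zero [simp]: "poly_eval x 0 = 0"
  by (simp add: poly_eval_def)

lemma poly_eval_sum: "poly_eval x (\<Sum>i\<in>I. f i) = (\<Sum>i\<in>I. poly_eval x (f i))"
  by (induction I rule: infinite_finite_induct) (auto simp: poly_eval_add)

lemma poly_eval_single: "poly_eval x (Poly_Mapping.single \<mu> c) = c * mono_eval x \<mu>"
  by (simp add: poly_eval_superset[where K = "{\<mu>}"])

lemma poly_sum_singles:
  "(\<Sum>\<mu>\<in>Poly_Mapping.keys p. Poly_Mapping.single \<mu> (Poly_Mapping.lookup p \<mu>)) = p"
proof (rule poly_mapping_eqI)
  fix k
  show "Poly_Mapping.lookup (\<Sum>\<mu>\<in>Poly_Mapping.keys p.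
      Poly_Mapping.single \<mu> (Poly_Mapping.lookup p \<mu>)) k = Poly_Mapping.lookup p k"
    by (cases "k \<in> Poly_Mapping.keys p")
       (auto simp: lookup_sum lookup_single when_def sum.delta in_keys_iff)
qed

lemma poly_eval_mult: "poly_eval x (p * q) = poly_eval x p * poly_eval x q"
proof -
  let ?s = "\<lambda>p \<mu>. Poly_Mapping.single \<mu> (Poly_Mapping.lookup p \<mu>)"
  have "p * q = (\<Sum>\<mu>\<in>Poly_Mapping.keys p. ?s p \<mu>) * (\<Sum>\<nu>\<in>Poly_Mapping.keys q. ?s q \<nu>)"
    by (simp only: poly_sum_singles)
  also have "\<dots> = (\<Sum>\<mu>\<in>Poly_Mapping.keys p. \<Sum>\<nu>\<in>Poly_Mapping.keys q.
      Poly_Mapping.single (\<mu> + \<nu>) (Poly_Mapping.lookup p \<mu> * Poly_Mapping.lookup q \<nu>))"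
    by (simp add: sum_product mult_single)
  finally have "poly_eval x (p * q) = (\<Sum>\<mu>\<in>Poly_Mapping.keys p. \<Sum>\<nu>\<in>Poly_Mapping.keys q.
      (Poly_Mapping.lookup p \<mu> * mono_eval x \<mu>) * (Poly_Mapping.lookup q \<nu> * mono_eval x \<nu>))"
    by (simp add: poly_eval_sum poly_eval_single mono_eval_add mult_ac)
  also have "\<dots> = poly_eval x p * poly_eval x q"
    unfolding poly_eval_def mono_eval_def by (simp add: sum_product)
  finally show ?thesis .
qed

lemma multiforms_mult:
  assumes "p \<in> multiforms n m" "q \<in> multiforms n m"
  shows "p * q \<in> multiforms n m"
proof -
  from assms obtain d e where
    d: "\<And>\<mu>. \<mu> \<in> Poly_Mapping.keys p \<Longrightarrow> Poly_Mapping.keys \<mu> \<subseteq> {..<m} \<times> {..n} \<and>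
          (\<forall>i<m. (\<Sum>j\<le>n. Poly_Mapping.lookup \<mu> (i, j)) = d i)" and
    e: "\<And>\<mu>. \<mu> \<in> Poly_Mapping.keys q \<Longrightarrow> Poly_Mapping.keys \<mu> \<subseteq> {..<m} \<times> {..n} \<and>
          (\<forall>i<m. (\<Sum>j\<le>n. Poly_Mapping.lookup \<mu> (i, j)) = e i)"
    unfolding multiforms_def by blast
  have "Poly_Mapping.keys \<mu> \<subseteq> {..<m} \<times> {..n} \<and>
        (\<forall>i<m. (\<Sum>j\<le>n. Poly_Mapping.lookup \<mu> (i, j)) = d i + e i)"
    if "\<mu> \<in> Poly_Mapping.keys (p * q)" for \<mu>
  proof -
    from that keys_mult[of p q] obtain \<alpha> \<beta> where
      "\<mu> = \<alpha> + \<beta>" "\<alpha> \<in> Poly_Mapping.keys p" "\<beta> \<in> Poly_Mapping.keys q" by blast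
    then show ?thesis
      using d[of \<alpha>] e[of \<beta>] Poly_Mapping.keys_add[of \<alpha> \<beta>]
      by (auto simp: lookup_add sum.distrib)
  qed
  then show ?thesis
    unfolding multiforms_def mem_Collect_eq
    by (intro exI[of _ "\<lambda>i. d i + e i"] ballI)
qed

lemma multiform_eval_scale:
  assumes "p \<in> multiforms n m"
  obtains d :: "nat \<Rightarrow> nat" where
    "\<And>c x y. (\<And>i j. i < m \<Longrightarrow> j \<le> n \<Longrightarrow> x (i, j) = c i * y (i, j)) \<Longrightarrow>
       poly_eval x p = (\<Prod>i<m. c i ^ d i) * poly_eval y p"
proof -
  from assms obtain d where
    d: "\<And>\<mu>. \<mu> \<in> Poly_Mapping.keys p \<Longrightarrow> Poly_Mapping.keys \<mu> \<subseteq> {..<m} \<times> {..n} \<and>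
          (\<forall>i<m. (\<Sum>j\<le>n. Poly_Mapping.lookup \<mu> (i, j)) = d i)"
    unfolding multiforms_def by blast
  have "poly_eval x p = (\<Prod>i<m. c i ^ d i) * poly_eval y p"
    if xy: "\<And>i j. i < m \<Longrightarrow> j \<le> n \<Longrightarrow> x (i, j) = c i * y (i, j)" for c x y
  proof -
    have "mono_eval x \<mu> = (\<Prod>i<m. c i ^ d i) * mono_eval y \<mu>"
      if "\<mu> \<in> Poly_Mapping.keys p" for \<mu>
    proof -
      let ?l = "Poly_Mapping.lookup \<mu>"
      have K: "Poly_Mapping.keys \<mu> \<subseteq> {..<m} \<times> {..n}" using d[OF that] by simp
      have "mono_eval x \<mu> = (\<Prod>i<m. \<Prod>j\<le>n. x (i, j) ^ ?l (i, j))"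
        using K by (simp add: mono_eval_superset[where K = "{..<m} \<times> {..n}"]
            prod.cartesian_product case_prod_unfold)
      also have "\<dots> = (\<Prod>i<m. \<Prod>j\<le>n. c i ^ ?l (i, j) * y (i, j) ^ ?l (i, j))"
        by (intro prod.cong refl) (simp add: xy power_mult_distrib)
      also have "\<dots> = (\<Prod>i<m. c i ^ d i) * (\<Prod>i<m. \<Prod>j\<le>n. y (i, j) ^ ?l (i, j))"
        using d[OF that] by (simp add: prod.distrib flip: power_sum)
      also have "(\<Prod>i<m. \<Prod>j\<le>n. y (i, j) ^ ?l (i, j)) = mono_eval y \<mu>"
        using K by (simp add: mono_eval_superset[where K = "{..<m} \<times> {..n}"]
            prod.cartesian_product case_prod_unfold)
      finally show ?thesis .
    qed
    then show ?thesis
      unfolding poly_eval_def mono_eval_def[symmetric]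
      by (simp add: sum_distrib_left mult_ac)
  qed
  then show thesis by (rule that)
qed

lemma vanishes_at_iff:
  assumes p: "p \<in> multiforms n m" and xs: "xs \<in> proj_tuples n m"
    and r: "\<And>i. i < m \<Longrightarrow> r i \<in> xs ! i - {0\<^sub>v (n + 1)}"
  shows "vanishes_at n p xs \<longleftrightarrow> poly_eval (\<lambda>(i, j). r i $ j) p = 0"
proof
  assume "vanishes_at n p xs"
  then show "poly_eval (\<lambda>(i, j). r i $ j) p = 0"
    using r xs by (auto simp: vanishes_at_def proj_tuples_def)
next
  assume z: "poly_eval (\<lambda>(i, j). r i $ j) p = 0"
  show "vanishes_at n p xs"
    unfolding vanishes_at_def
  proof (intro allI impI)
    fix s assume s: "\<forall>i<length xs. s i \<in> xs ! i - {0\<^sub>v (n + 1)}"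
    have "\<exists>c. \<forall>j\<le>n. s i $ j = c * r i $ j" if i: "i < m" for i
    proof -
      from xs i have "xs ! i \<in> proj_space n" by (auto simp: proj_tuples_def)
      then obtain v where v: "v \<in> carrier_vec (n + 1)" "xs ! i = proj_point v"
        by (auto simp: proj_space_def)
      from s i xs have "s i \<in> proj_point v" by (auto simp: proj_tuples_def v)
      then obtain a where a: "s i = a \<cdot>\<^sub>v v" by (auto simp: proj_point_def)
      from r[OF i] obtain b where b: "r i = b \<cdot>\<^sub>v v" "r i \<noteq> 0\<^sub>v (n + 1)"
        by (auto simp: v proj_point_def)
      have "b \<noteq> 0" using b v by auto
      then show ?thesis using a b v by (intro exI[of _ "a / b"]) auto
    qed
    then obtain c where c: "\<And>i j. i < m \<Longrightarrow> j \<le> n \<Longrightarrow> s i $ j = c i * r i $ j" by metis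
    obtain d where d: "\<And>c x y. (\<And>i j. i < m \<Longrightarrow> j \<le> n \<Longrightarrow> x (i, j) = c i * y (i, j)) \<Longrightarrow>
       poly_eval x p = (\<Prod>i<m. c i ^ d i) * poly_eval y p"
      by (rule multiform_eval_scale[OF p]) blast
    have "poly_eval (\<lambda>(i, j). s i $ j) p =
        (\<Prod>i<m. c i ^ d i) * poly_eval (\<lambda>(i, j). r i $ j) p"
      by (rule d) (simp add: c)
    then show "poly_eval (\<lambda>(i, j). s i $ j) p = 0" using z by simp
  qed
qed

lemma ex_representatives:
  assumes "xs \<in> proj_tuples n m"
  obtains r where "\<And>i. i < m \<Longrightarrow> r i \<in> xs ! i - {0\<^sub>v (n + 1)}"
proof -
  have "\<exists>v. v \<in> xs ! i - {0\<^sub>v (n + 1)}" if "i < m" for i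
  proof -
    from assms that have "xs ! i \<in> proj_space n" by (auto simp: proj_tuples_def)
    then obtain v where "v \<noteq> 0\<^sub>v (n + 1)" "xs ! i = proj_point v"
      by (auto simp: proj_space_def)
    moreover have "v \<in> proj_point v"
      unfolding proj_point_def by (metis (mono_tags, lifting) mem_Collect_eq one_smult_vec)
    ultimately show ?thesis by blast
  qed
  then show thesis using that by metis
qed

lemma vanishes_at_mult:
  assumes "p \<in> multiforms n m" "q \<in> multiforms n m" "xs \<in> proj_tuples n m"
  shows "vanishes_at n (p * q) xs \<longleftrightarrow> vanishes_at n p xs \<or> vanishes_at n q xs"
proof -
  obtain r where r: "\<And>i. i < m \<Longrightarrow> r i \<in> xs ! i - {0\<^sub>v (n + 1)}"
    using ex_representatives[OF assms(3)] by blast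
  have iff: "vanishes_at n f xs \<longleftrightarrow> poly_eval (\<lambda>(i, j). r i $ j) f = 0" if "f \<in> multiforms n m" for f
    using that assms(3) r by (rule vanishes_at_iff)
  show ?thesis
    unfolding iff[OF multiforms_mult[OF assms(1,2)]] iff[OF assms(1)] iff[OF assms(2)]
    by (simp add: poly_eval_mult)
qed

lemma istopology_zariski:
  "istopology (\<lambda>U. U \<subseteq> proj_tuples n m \<and>
     (\<exists>S \<subseteq> multiforms n m. proj_tuples n m - U = zero_locus n m S))"
  unfolding istopology_def
proof (intro conjI allI impI)
  fix U V
  assume U: "U \<subseteq> proj_tuples n m \<and> (\<exists>S \<subseteq> multiforms n m. proj_tuples n m - U = zero_locus n m S)"
    and V: "V \<subseteq> proj_tuples n m \<and> (\<exists>S \<subseteq> multiforms n m. proj_tuples n m - V = zero_locus n m S)"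
  then show "U \<inter> V \<subseteq> proj_tuples n m" by blast
  from U V obtain S S' where S: "S \<subseteq> multiforms n m" "proj_tuples n m - U = zero_locus n m S"
    and S': "S' \<subseteq> multiforms n m" "proj_tuples n m - V = zero_locus n m S'" by blast
  let ?P = "{p * q | p q. p \<in> S \<and> q \<in> S'}"
  have sub: "?P \<subseteq> multiforms n m"
  proof
    fix f assume "f \<in> ?P"
    then obtain p q where "f = p * q" "p \<in> S" "q \<in> S'" by blast
    then show "f \<in> multiforms n m" using S(1) S'(1) multiforms_mult by (metis subsetD)
  qed
  have "zero_locus n m ?P = zero_locus n m S \<union> zero_locus n m S'"
  proof (rule Set.set_eqI)
    fix xs
    show "xs \<in> zero_locus n m ?P \<longleftrightarrow> xs \<in> zero_locus n m S \<union> zero_locus n m S'"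
    proof (cases "xs \<in> proj_tuples n m")
      case True
      have "(\<forall>f\<in>?P. vanishes_at n f xs) \<longleftrightarrow>
          (\<forall>p\<in>S. \<forall>q\<in>S'. vanishes_at n (p * q) xs)" by blast
      also have "\<dots> \<longleftrightarrow> (\<forall>p\<in>S. \<forall>q\<in>S'. vanishes_at n p xs \<or> vanishes_at n q xs)"
      proof -
        have "vanishes_at n (p * q) xs \<longleftrightarrow> vanishes_at n p xs \<or> vanishes_at n q xs"
          if "p \<in> S" "q \<in> S'" for p q
          by (rule vanishes_at_mult) (use that S(1) S'(1) True in auto)
        then show ?thesis by simp
      qed
      finally show ?thesis using True unfolding zero_locus_def by blast
    qed (simp add: zero_locus_def)
  qed
  moreover have "proj_tuples n m - U \<inter> V = (proj_tuples n m - U) \<union> (proj_tuples n m - V)"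
    by blast
  ultimately have "proj_tuples n m - U \<inter> V = zero_locus n m ?P" using S S' by simp
  with sub show "\<exists>S \<subseteq> multiforms n m. proj_tuples n m - U \<inter> V = zero_locus n m S" by blast
next
  fix K
  assume K: "\<forall>U\<in>K. U \<subseteq> proj_tuples n m \<and>
    (\<exists>S \<subseteq> multiforms n m. proj_tuples n m - U = zero_locus n m S)"
  then show "\<Union>K \<subseteq> proj_tuples n m" by blast
  from K obtain S where S: "\<And>U. U \<in> K \<Longrightarrow> S U \<subseteq> multiforms n m"
    "\<And>U. U \<in> K \<Longrightarrow> proj_tuples n m - U = zero_locus n m (S U)" by metis
  have "proj_tuples n m - \<Union>K = {xs \<in> proj_tuples n m. \<forall>U\<in>K. xs \<in> proj_tuples n m - U}"
    by blast
  also have "\<dots> = {xs \<in> proj_tuples n m. \<forall>U\<in>K. xs \<in> zero_locus n m (S U)}"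
    using S(2) by blast
  also have "\<dots> = zero_locus n m (\<Union>(S ` K))"
    unfolding zero_locus_def by blast
  finally have "proj_tuples n m - \<Union>K = zero_locus n m (\<Union>(S ` K))" .
  moreover have "\<Union>(S ` K) \<subseteq> multiforms n m"
    by (rule UN_least) (rule S(1))
  ultimately show "\<exists>S \<subseteq> multiforms n m. proj_tuples n m - \<Union>K = zero_locus n m S"
    by (intro exI[of _ "\<Union>(S ` K)"] conjI)
qed

lemma openin_zariski_product:
  "openin (zariski_product n m) U \<longleftrightarrow> U \<subseteq> proj_tuples n m \<and>
     (\<exists>S \<subseteq> multiforms n m. proj_tuples n m - U = zero_locus n m S)"
  unfolding zariski_product_def by (simp add: istopology_zariski)

lemma topspace_zariski_product [simp]: "topspace (zariski_product n m) = proj_tuples n m"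
proof -
  have "poly_eval x (1 :: (nat \<times> nat) cpoly) = 1" for x
    by (simp add: poly_eval_def)
  then have v: "\<not> vanishes_at n 1 xs" if "xs \<in> proj_tuples n m" for xs
    using ex_representatives[OF that] that
    by (auto simp: vanishes_at_def proj_tuples_def) metis
  have "(1 :: (nat \<times> nat) cpoly) \<in> multiforms n m"
    by (auto simp: multiforms_def)
  moreover have "zero_locus n m {1} = {}" using v by (auto simp: zero_locus_def)
  ultimately have "openin (zariski_product n m) (proj_tuples n m)"
    by (auto simp: openin_zariski_product intro!: exI[of _ "{1}"])
  then show ?thesis
    by (metis openin_subset openin_topspace openin_zariski_product subset_antisym)
qed

lemma closedin_zariski_product:
  "closedin (zariski_product n m) Z \<longleftrightarrow> (\<exists>S \<subseteq> multiforms n m. Z = zero_locus n m S)"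
proof -
  have "zero_locus n m S \<subseteq> proj_tuples n m" for S by (auto simp: zero_locus_def)
  then show ?thesis
    by (auto simp: closedin_def openin_zariski_product double_diff)
qed

lemma openin_quotient_topology:
  "openin (quotient_topology X f) U \<longleftrightarrow>
     U \<subseteq> f ` topspace X \<and> openin X {x \<in> topspace X. f x \<in> U}"
proof -
  have "istopology (\<lambda>U. U \<subseteq> f ` topspace X \<and> openin X {x \<in> topspace X. f x \<in> U})"
    unfolding istopology_def
  proof (intro conjI allI impI; (elim conjE)?)
    fix S T assume "openin X {x \<in> topspace X. f x \<in> S}" "openin X {x \<in> topspace X. f x \<in> T}"
    then have "openin X ({x \<in> topspace X. f x \<in> S} \<inter> {x \<in> topspace X. f x \<in> T})" by blast
    then show "openin X {x \<in> topspace X. f x \<in> S \<inter> T}"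
      by (rule back_subst[where P = "openin X"]) blast
  next
    fix K assume "\<forall>U\<in>K. U \<subseteq> f ` topspace X \<and> openin X {x \<in> topspace X. f x \<in> U}"
    then have "openin X (\<Union>U\<in>K. {x \<in> topspace X. f x \<in> U})" by blast
    then show "openin X {x \<in> topspace X. f x \<in> \<Union>K}"
      by (rule back_subst[where P = "openin X"]) blast
  qed blast+
  then show ?thesis by (simp add: quotient_topology_def)
qed

lemma topspace_quotient_topology [simp]: "topspace (quotient_topology X f) = f ` topspace X"
proof -
  have "{x \<in> topspace X. f x \<in> f ` topspace X} = topspace X" by blast
  then have "openin (quotient_topology X f) (f ` topspace X)"
    by (simp add: openin_quotient_topology)
  then show ?thesis
    by (metis openin_subset openin_topspace openin_quotient_topology subset_antisym)
qed

end

theory Submission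
  imports Defs "HOL-Computational_Algebra.Fundamental_Theorem_Algebra"
begin

text \<open>
  In an affine coordinate of \<open>\<Gamma>\<close> whose point at infinity is not in \<open>A\<close>, a sum of fourth powers of
  points of \<open>\<Gamma>\<close> with parameters \<open>a_i\<close> and weights \<open>c_i\<close> is determined by the functional
  \<open>p \<mapsto> \<Sum> c_i p(a_i)\<close> on polynomials of degree at most \<open>4n\<close>.  Let \<open>g0 = \<Prod> (x - a_i)\<close>, and let \<open>g1\<close> be
  the polynomial of degree at most \<open>2n\<close> with \<open>g1(a_i) = 1 / (c_i g0'(a_i))\<close>; the \<open>c_i\<close> are nonzero by
  minimality.  By Lagrange interpolation the functional kills every multiple of \<open>g0 + t g1\<close>, so it is
  a combination of evaluations at the roots of \<open>g0 + t g1\<close> whenever these are \<open>2n + 1\<close> distinct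
  points.  The root sets obtained this way form the family.

  The family is locally closed: \<open>2n + 1\<close> distinct affine points form a member iff
  \<open>g0(x) g1(y) = g0(y) g1(x)\<close> for all of their pairs, and since \<open>2n + 1 \<le> 3n\<close> this is given by
  bicubic forms.  Irreducibility and positive dimension follow once a closed set containing infinitely
  many members contains all of them.  To see this, sum a polynomial in \<open>2n + 1\<close> variables over all
  tuples of roots of \<open>g0 + t g1\<close>, with Lagrange weights: the result is polynomial in \<open>t\<close>.  Multiplying by
  the Vandermonde product and by Lagrange basis polynomials isolates a single ordering of the roots.
\<close>

section \<open>Lagrange interpolation\<close>

definition lagrange_basis :: "complex set \<Rightarrow> complex \<Rightarrow> complex poly" where
  "lagrange_basis R r = (\<Prod>s\<in>R - {r}. smult (1 / (r - s)) [:- s, 1:])"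

text \<open>For finite \<open>R\<close> and \<open>r\<close> in \<open>R\<close> this is
  \<open>1 / g'(r)\<close>, where \<open>g\<close> is the monic polynomial with simple root set
  \<open>R\<close>. It is also the leading coefficient of \<open>lagrange_basis R r\<close>.\<close>

definition lagrange_weight :: "complex set \<Rightarrow> complex \<Rightarrow> complex" where
  "lagrange_weight R r = (\<Prod>s\<in>R - {r}. 1 / (r - s))"

lemma lagrange_weight_nonzero:
  assumes "finite R" shows "lagrange_weight R r \<noteq> 0"
  using assms by (auto simp: lagrange_weight_def)

lemma poly_lagrange_basis:
  assumes "finite R" "r \<in> R" "s \<in> R"
  shows "poly (lagrange_basis R r) s = (if s = r then 1 else 0)"
proof (cases "s = r")
  case True
  then show ?thesis
    unfolding lagrange_basis_def poly_prod poly_smult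
    by (auto intro!: prod.neutral split: if_splits)
next
  case False
  with assms have "s \<in> R - {r}" "finite (R - {r})" by auto
  then show ?thesis
    using False unfolding lagrange_basis_def poly_prod
    by (simp only: if_False, subst prod_zero_iff) (auto intro!: bexI[of _ s])
qed

lemma lagrange_basis_eq:
  "lagrange_basis R r = smult (lagrange_weight R r) (\<Prod>s\<in>R - {r}. [:- s, 1:])"
  unfolding lagrange_basis_def lagrange_weight_def prod_smult ..

lemma lead_coeff_prod_linear: "lead_coeff (\<Prod>s\<in>R. [:- s, 1:]) = (1 :: complex)"
  by (simp add: lead_coeff_prod)

lemma degree_prod_linear: "degree (\<Prod>s\<in>R. [:- s, 1 :: complex:]) = card R"
  by (subst degree_prod_eq_sum_degree) auto

lemma degree_lagrange_basis:
  assumes "finite R" "r \<in> R"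
  shows "degree (lagrange_basis R r) = card R - 1"
  using lagrange_weight_nonzero[OF assms(1), of r] assms
  by (simp add: lagrange_basis_eq degree_prod_linear)

lemma coeff_lagrange_basis:
  assumes "finite R" "r \<in> R"
  shows "coeff (lagrange_basis R r) (card R - 1) = lagrange_weight R r"
proof -
  have "coeff (\<Prod>s\<in>R - {r}. [:- s, 1:]) (card R - 1) = (1 :: complex)"
    using lead_coeff_prod_linear[of "R - {r}"] assms by (simp add: degree_prod_linear)
  then show ?thesis by (simp add: lagrange_basis_eq)
qed

lemma poly_eq_of_card_roots:
  fixes p q :: "complex poly"
  assumes "degree (p - q) < card R" "\<And>r. r \<in> R \<Longrightarrow> poly p r = poly q r"
  shows "p = q"
proof (rule ccontr)
  assume "p \<noteq> q"
  then have nz: "p - q \<noteq> 0" by simp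
  have "card R \<le> card {x. poly (p - q) x = 0}"
    using assms(2) by (intro card_mono poly_roots_finite nz) auto
  also have "\<dots> \<le> degree (p - q)" by (rule card_poly_roots_bound[OF nz])
  finally show False using assms(1) by simp
qed

lemma degree_lagrange_sum:
  assumes "finite R" "R \<noteq> {}"
  shows "degree (\<Sum>r\<in>R. smult (v r) (lagrange_basis R r)) < card R"
proof -
  have "degree (\<Sum>r\<in>R. smult (v r) (lagrange_basis R r)) \<le> card R - 1"
    using assms by (intro degree_sum_le) (auto simp: degree_lagrange_basis intro: order_trans[OF degree_smult_le])
  then show ?thesis using assms by (simp add: card_gt_0_iff le_less_trans)
qed

lemma poly_lagrange_sum:
  assumes "finite R" "s \<in> R"
  shows "poly (\<Sum>r\<in>R. smult (v r) (lagrange_basis R r)) s = v s"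
proof -
  have "poly (\<Sum>r\<in>R. smult (v r) (lagrange_basis R r)) s = (\<Sum>r\<in>R. if r = s then v s else 0)"
    unfolding poly_sum using assms by (intro sum.cong) (auto simp: poly_lagrange_basis)
  then show ?thesis using assms by simp
qed

lemma lagrange_interpolation:
  assumes "finite R" "degree p < card R"
  shows "p = (\<Sum>r\<in>R. smult (poly p r) (lagrange_basis R r))"
proof (rule poly_eq_of_card_roots)
  have "R \<noteq> {}" using assms by auto
  then show "degree (p - (\<Sum>r\<in>R. smult (poly p r) (lagrange_basis R r))) < card R"
    using assms degree_lagrange_sum by (intro degree_diff_less) auto
qed (use assms poly_lagrange_sum in auto)

text \<open>Compare the coefficients of degree \<open>card R - 1\<close> in the interpolation
  formula. The sum is therefore 0 as soon as \<open>degree p < card R - 1\<close>, which is how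
  functionals are seen to kill multiples of pencil members.\<close>

lemma sum_lagrange_weight:
  assumes "finite R" "degree p < card R"
  shows "(\<Sum>r\<in>R. poly p r * lagrange_weight R r) = coeff p (card R - 1)"
proof -
  have "coeff p (card R - 1) = coeff (\<Sum>r\<in>R. smult (poly p r) (lagrange_basis R r)) (card R - 1)"
    using lagrange_interpolation[OF assms] by simp
  also have "\<dots> = (\<Sum>r\<in>R. poly p r * lagrange_weight R r)"
    unfolding coeff_sum coeff_smult using assms
    by (intro sum.cong) (simp_all only: coeff_lagrange_basis)
  finally show ?thesis by simp
qed

lemma card_roots_rsquarefree:
  fixes p :: "complex poly"
  assumes "rsquarefree p" "p \<noteq> 0"
  shows "card {x. poly p x = 0} = degree p"
  using complex_poly_decompose_rsquarefree[OF assms(1)] assms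
  by (metis degree_prod_linear degree_smult_eq leading_coeff_0_iff)

section \<open>Pencils of polynomials\<close>

text \<open>The pencil spanned by \<open>g0\<close> and \<open>g1\<close>, without the member
  \<open>g1\<close> itself. As \<open>g0\<close> and \<open>g1\<close> have no common zero,
  different parameters have disjoint root sets.\<close>

locale polynomial_pencil =
  fixes g0 g1 :: "complex poly" and m :: nat
  assumes deg_g0: "degree g0 = m" and monic_g0: "lead_coeff g0 = 1"
    and deg_g1: "degree g1 < m"
    and card_roots_g0: "card {x. poly g0 x = 0} = m"
    and no_base_point: "\<And>x. poly g0 x = 0 \<Longrightarrow> poly g1 x \<noteq> 0"
begin

definition member :: "complex \<Rightarrow> complex poly" where
  "member t = g0 + smult t g1"

definition fibre :: "complex \<Rightarrow> complex set" where
  "fibre t = {x. poly (member t) x = 0}"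

text \<open>The parameters whose member, which has degree \<open>m\<close>, has only simple
  roots.\<close>

definition good :: "complex set" where
  "good = {t. card (fibre t) = m}"

lemma m_pos: "0 < m"
  using deg_g1 by simp

lemma g1_nonzero: "g1 \<noteq> 0"
proof -
  have "{x. poly g0 x = 0} \<noteq> {}" using card_roots_g0 m_pos by (metis card.empty less_irrefl)
  then show ?thesis using no_base_point by auto
qed

lemma degree_member: "degree (member t) = m"
  unfolding member_def using deg_g0 deg_g1 degree_smult_le[of t g1]
  by (subst degree_add_eq_left) auto

lemma coeff_member: "coeff (member t) m = 1"
  unfolding member_def using deg_g0 monic_g0 deg_g1 by (simp add: coeff_eq_0)

lemma member_nonzero: "member t \<noteq> 0"
  using coeff_member[of t] by auto

lemma finite_fibre: "finite (fibre t)"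
  unfolding fibre_def by (rule poly_roots_finite[OF member_nonzero])

lemma zero_good: "0 \<in> good"
  using card_roots_g0 by (simp add: good_def fibre_def member_def)

lemma fibre_zero: "fibre 0 = {x. poly g0 x = 0}"
  by (simp add: fibre_def member_def)

lemma fibre_iff: "x \<in> fibre t \<longleftrightarrow> poly g0 x + t * poly g1 x = 0"
  by (simp add: fibre_def member_def)

text \<open>A common root of two different members would be a base point, because subtracting the
  two equations leaves \<open>(s - t) * poly g1 x = 0\<close>. Goodness of \<open>s\<close> provides
  a point of its fibre.\<close>

lemma fibre_subset_imp_eq:
  assumes "s \<in> good" "fibre s \<subseteq> fibre t"
  shows "s = t"
proof (rule ccontr)
  assume "s \<noteq> t"
  have "fibre s \<noteq> {}" using assms m_pos by (auto simp: good_def)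
  then obtain x where "x \<in> fibre s" "x \<in> fibre t" using assms by blast
  then have e: "poly g0 x + s * poly g1 x = 0" "poly g0 x + t * poly g1 x = 0"
    by (simp_all add: fibre_iff)
  have "(s - t) * poly g1 x = (poly g0 x + s * poly g1 x) - (poly g0 x + t * poly g1 x)"
    by (simp add: algebra_simps)
  with e have "(s - t) * poly g1 x = 0" by simp
  with \<open>s \<noteq> t\<close> e have "poly g1 x = 0" "poly g0 x = 0" by auto
  then show False using no_base_point by blast
qed

lemma card_fibre_le: "card (fibre t) \<le> m"
  unfolding fibre_def using card_poly_roots_bound[OF member_nonzero] by (simp add: degree_member)

text \<open>A multiple root \<open>x\<close> of \<open>member t\<close> is a zero of the Wronskian
  \<open>?W\<close> of \<open>g0\<close> and \<open>g1\<close>, and \<open>x\<close> determines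
  \<open>t\<close> as \<open>- poly g0 x / poly g1 x\<close>. The Wronskian is not 0, since at a
  root \<open>a\<close> of \<open>g0\<close> it takes the value
  \<open>- g0'(a) * g1(a)\<close>.\<close>

lemma finite_not_good: "finite (- good)"
proof -
  let ?W = "g0 * pderiv g1 - pderiv g0 * g1"
  have bad: "\<exists>x. poly (member t) x = 0 \<and> poly (pderiv (member t)) x = 0" if "t \<notin> good" for t
    using card_roots_rsquarefree[OF _ member_nonzero, of t] that
    by (auto simp: rsquarefree_roots good_def fibre_def degree_member)
  have "?W \<noteq> 0"
  proof -
    \<comment> \<open>If \<open>a\<close> were a multiple root, the cofactor \<open>h\<close> of
      degree \<open>m - 1\<close> would vanish at all \<open>m\<close> roots of
      \<open>g0\<close>.\<close>
    have sq: "rsquarefree g0"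
    proof (rule ccontr)
      assume "\<not> rsquarefree g0"
      then obtain a where a: "poly g0 a = 0" "poly (pderiv g0) a = 0"
        by (auto simp: rsquarefree_roots)
      then obtain h where h: "g0 = [:- a, 1:] * h" by (auto simp: poly_eq_0_iff_dvd)
      have g0: "g0 \<noteq> 0" using monic_g0 by auto
      with h have hnz: "h \<noteq> 0" by auto
      have "poly h a = 0" using a(2) unfolding h pderiv_mult by (simp add: pderiv_pCons)
      then have "{x. poly g0 x = 0} = {x. poly h x = 0}" unfolding h by auto
      then have "m \<le> degree h" using card_roots_g0 card_poly_roots_bound[OF hnz] by simp
      moreover have "degree g0 = Suc (degree h)"
        unfolding h using hnz by (subst degree_mult_eq) auto
      ultimately show False using deg_g0 by simp
    qed
    have "{x. poly g0 x = 0} \<noteq> {}" using card_roots_g0 m_pos by (metis card.empty less_irrefl)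
    then obtain a where a: "poly g0 a = 0" by blast
    have "poly (pderiv g0) a \<noteq> 0" using sq a by (auto simp: rsquarefree_roots)
    then have nz: "poly ?W a \<noteq> 0" using a no_base_point[OF a] by simp
    show ?thesis
    proof
      assume "?W = 0"
      then have "poly ?W a = poly 0 a" by (rule arg_cong)
      with nz show False by simp
    qed
  qed
  then have fin: "finite {x. poly ?W x = 0}" by (rule poly_roots_finite)
  have "- good \<subseteq> (\<lambda>x. - poly g0 x / poly g1 x) ` {x. poly ?W x = 0}"
  proof
    fix t assume "t \<in> - good"
    then obtain x where x: "poly g0 x + t * poly g1 x = 0"
      "poly (pderiv g0) x + t * poly (pderiv g1) x = 0"
      using bad[of t] by (auto simp: member_def pderiv_add pderiv_smult)
    have nz: "poly g1 x \<noteq> 0" using x(1) no_base_point[of x] by auto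
    have e: "poly g0 x = - t * poly g1 x" "poly (pderiv g0) x = - t * poly (pderiv g1) x"
      using x by (auto simp: eq_neg_iff_add_eq_0)
    have "poly ?W x = 0" by (simp add: e)
    moreover have "t = - poly g0 x / poly g1 x" using nz e(1) by simp
    ultimately show "t \<in> (\<lambda>x. - poly g0 x / poly g1 x) ` {x. poly ?W x = 0}" by blast
  qed
  then show ?thesis using fin finite_surj by blast
qed

lemma infinite_good: "infinite good"
  using finite_not_good infinite_UNIV_char_0[where 'a = complex] finite_Un[of good "- good"]
  by (simp add: Compl_partition)

text \<open>Because \<open>degree g1 < m\<close>, some \<open>x\<close> in \<open>Y\<close> has
  \<open>poly g1 x \<noteq> 0\<close>. The relations with this \<open>x\<close> put \<open>Y\<close>
  inside one fibre, and counting gives equality.\<close>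

lemma fibre_characterization:
  assumes "card Y = m"
    and "\<And>x y. x \<in> Y \<Longrightarrow> y \<in> Y \<Longrightarrow> poly g0 x * poly g1 y - poly g0 y * poly g1 x = 0"
  obtains t where "t \<in> good" "Y = fibre t"
proof -
  have "\<exists>x\<in>Y. poly g1 x \<noteq> 0"
  proof (rule ccontr)
    assume "\<not> ?thesis"
    then have "Y \<subseteq> {x. poly g1 x = 0}" by auto
    then have "m \<le> card {x. poly g1 x = 0}"
      using assms(1) card_mono poly_roots_finite[OF g1_nonzero] by metis
    then show False using card_poly_roots_bound[OF g1_nonzero] deg_g1 by simp
  qed
  then obtain x where x: "x \<in> Y" "poly g1 x \<noteq> 0" by blast
  define t where "t = - poly g0 x / poly g1 x"
  have "Y \<subseteq> fibre t"
  proof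
    fix y assume "y \<in> Y"
    from assms(2)[OF x(1) this] x(2) show "y \<in> fibre t"
      by (simp add: fibre_iff t_def field_simps)
  qed
  moreover have "Y = fibre t"
    using calculation card_fibre_le assms(1) by (metis card_seteq finite_fibre)
  ultimately show thesis using that assms(1) by (auto simp: good_def)
qed

end

subsection \<open>Traces over the fibres\<close>

context polynomial_pencil
begin

abbreviation fibre_tuples :: "complex \<Rightarrow> (nat \<Rightarrow> complex) set" where
  "fibre_tuples t \<equiv> PiE {..<m} (\<lambda>_. fibre t)"

text \<open>For \<open>k < m\<close> the sum is a coefficient of \<open>x ^ k\<close>, hence
  constant in \<open>t\<close>. For larger \<open>k\<close> the equation of the fibre rewrites
  \<open>r ^ k\<close> in lower powers, with coefficients linear in \<open>t\<close>.\<close>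

lemma weighted_power_sum_polynomial:
  "\<exists>Q. \<forall>t\<in>good. (\<Sum>r\<in>fibre t. r ^ k * lagrange_weight (fibre t) r) = poly Q t"
proof (induction k rule: less_induct)
  case (less k)
  show ?case
  proof (cases "k < m")
    case True
    have "(\<Sum>r\<in>fibre t. r ^ k * lagrange_weight (fibre t) r) = poly [:coeff (monom 1 k) (m - 1):] t"
      if "t \<in> good" for t
      using sum_lagrange_weight[OF finite_fibre, of "monom 1 k" t] that True
      by (simp add: poly_monom good_def degree_monom_eq)
    then show ?thesis by blast
  next
    case False
    have "\<forall>j\<in>{..<m}. \<exists>Q. \<forall>t\<in>good.
        (\<Sum>r\<in>fibre t. r ^ (k - m + j) * lagrange_weight (fibre t) r) = poly Q t"
      using less False by auto
    then obtain Q where Q: "\<And>j t. j < m \<Longrightarrow> t \<in> good \<Longrightarrow>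
        (\<Sum>r\<in>fibre t. r ^ (k - m + j) * lagrange_weight (fibre t) r) = poly (Q j) t"
      unfolding bchoice_iff by blast
    \<comment> \<open>\<open>[:coeff g0 j, coeff g1 j:]\<close> is the \<open>j\<close>-th
      coefficient of \<open>member t\<close>, viewed as a polynomial in \<open>t\<close>.\<close>
    have "(\<Sum>r\<in>fibre t. r ^ k * lagrange_weight (fibre t) r) =
        poly (- (\<Sum>j<m. [:coeff g0 j, coeff g1 j:] * Q j)) t" if t: "t \<in> good" for t
    proof -
      have red: "r ^ k = - (\<Sum>j<m. coeff (member t) j * r ^ (k - m + j))" if "r \<in> fibre t" for r
      proof -
        have "0 = poly (member t) r" using that by (simp add: fibre_def)
        also have "\<dots> = (\<Sum>j<m. coeff (member t) j * r ^ j) + r ^ m"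
          unfolding poly_altdef degree_member lessThan_Suc_atMost[symmetric]
          by (simp add: coeff_member)
        finally have "r ^ m = - (\<Sum>j<m. coeff (member t) j * r ^ j)"
          by (simp add: eq_neg_iff_add_eq_0 add.commute)
        moreover have "r ^ k = r ^ (k - m) * r ^ m"
          using False by (simp flip: power_add)
        ultimately show ?thesis
          by (simp add: sum_distrib_left power_add mult_ac)
      qed
      have "(\<Sum>r\<in>fibre t. r ^ k * lagrange_weight (fibre t) r) =
          - (\<Sum>r\<in>fibre t. \<Sum>j<m. coeff (member t) j *
              (r ^ (k - m + j) * lagrange_weight (fibre t) r))"
        unfolding sum_negf[symmetric]
        by (intro sum.cong) (simp_all add: red sum_distrib_left sum_negf mult_ac)
      also have "\<dots> = - (\<Sum>j<m. coeff (member t) j *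
          (\<Sum>r\<in>fibre t. r ^ (k - m + j) * lagrange_weight (fibre t) r))"
        by (subst sum.swap) (simp add: sum_distrib_left)
      also have "\<dots> = - (\<Sum>j<m. coeff (member t) j * poly (Q j) t)"
        using Q[OF _ t] by simp
      finally show ?thesis by (simp add: poly_sum member_def algebra_simps)
    qed
    then show ?thesis by blast
  qed
qed

lemma weighted_sum_polynomial:
  "\<exists>Q. \<forall>t\<in>good. (\<Sum>r\<in>fibre t. poly q r * lagrange_weight (fibre t) r) = poly Q t"
proof -
  obtain Q where Q: "\<And>k t. t \<in> good \<Longrightarrow>
      (\<Sum>r\<in>fibre t. r ^ k * lagrange_weight (fibre t) r) = poly (Q k) t"
    using weighted_power_sum_polynomial by metis
  have "(\<Sum>r\<in>fibre t. poly q r * lagrange_weight (fibre t) r) =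
      poly (\<Sum>k\<le>degree q. smult (coeff q k) (Q k)) t" if "t \<in> good" for t
  proof -
    have "(\<Sum>r\<in>fibre t. poly q r * lagrange_weight (fibre t) r) =
        (\<Sum>k\<le>degree q. \<Sum>r\<in>fibre t. coeff q k * (r ^ k * lagrange_weight (fibre t) r))"
      by (subst sum.swap) (simp add: poly_altdef sum_distrib_left mult_ac)
    then show ?thesis using Q[OF that]
      by (simp add: poly_sum sum_distrib_left[symmetric])
  qed
  then show ?thesis by blast
qed

text \<open>The trace runs over all ordered tuples from the fibre, repetitions included. Allowing
  arbitrary test polynomials \<open>q i\<close> makes the property stable under multiplication by
  polynomials in one coordinate, and later lets a single tuple be isolated.\<close>

definition has_polynomial_trace :: "((nat \<Rightarrow> complex) \<Rightarrow> complex) \<Rightarrow> bool" where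
  "has_polynomial_trace f \<longleftrightarrow> (\<forall>q. \<exists>Q. \<forall>t\<in>good. (\<Sum>x\<in>fibre_tuples t. f x *
     (\<Prod>i<m. poly (q i) (x i) * lagrange_weight (fibre t) (x i))) = poly Q t)"

text \<open>The sum over tuples factors into a product of sums over the fibre, one for each
  coordinate.\<close>

lemma has_polynomial_trace_const: "has_polynomial_trace (\<lambda>_. c)"
  unfolding has_polynomial_trace_def
proof
  fix q :: "nat \<Rightarrow> complex poly"
  have "\<forall>i. \<exists>Q. \<forall>t\<in>good.
      (\<Sum>r\<in>fibre t. poly (q i) r * lagrange_weight (fibre t) r) = poly Q t"
    by (intro allI weighted_sum_polynomial)
  then obtain Q where Q: "\<And>i t. t \<in> good \<Longrightarrow>
      (\<Sum>r\<in>fibre t. poly (q i) r * lagrange_weight (fibre t) r) = poly (Q i) t"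
    unfolding choice_iff by blast
  have "(\<Sum>x\<in>fibre_tuples t. c * (\<Prod>i<m. poly (q i) (x i) * lagrange_weight (fibre t) (x i))) =
      poly (smult c (\<Prod>i<m. Q i)) t" if "t \<in> good" for t
  proof -
    have "(\<Prod>i<m. poly (Q i) t) =
        (\<Prod>i<m. \<Sum>r\<in>fibre t. poly (q i) r * lagrange_weight (fibre t) r)"
      by (simp only: Q[OF that])
    also have "\<dots> = (\<Sum>x\<in>fibre_tuples t.
        \<Prod>i<m. poly (q i) (x i) * lagrange_weight (fibre t) (x i))"
      by (rule prod_sum_PiE) (simp_all add: finite_fibre)
    finally show ?thesis
      by (simp only: sum_distrib_left[symmetric] poly_smult poly_prod)
  qed
  then show "\<exists>Q. \<forall>t\<in>good. (\<Sum>x\<in>fibre_tuples t. c *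
     (\<Prod>i<m. poly (q i) (x i) * lagrange_weight (fibre t) (x i))) = poly Q t" by blast
qed

text \<open>The factor is absorbed into the \<open>i\<close>-th test polynomial.\<close>

lemma has_polynomial_trace_mult_poly:
  assumes "has_polynomial_trace f" "i < m"
  shows "has_polynomial_trace (\<lambda>x. poly p (x i) * f x)"
  unfolding has_polynomial_trace_def
proof
  fix q
  define q' where "q' = q(i := p * q i)"
  have q': "f x * (\<Prod>j<m. poly (q' j) (x j) * w (x j)) =
      poly p (x i) * f x * (\<Prod>j<m. poly (q j) (x j) * w (x j))" for x w
    using assms(2) by (simp add: prod.remove[of "{..<m}" i] mult_ac q'_def)
  show "\<exists>Q. \<forall>t\<in>good. (\<Sum>x\<in>fibre_tuples t. poly p (x i) * f x *
     (\<Prod>i<m. poly (q i) (x i) * lagrange_weight (fibre t) (x i))) = poly Q t"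
    unfolding q'[symmetric] using assms(1) unfolding has_polynomial_trace_def by blast
qed

lemma has_polynomial_trace_add:
  assumes "has_polynomial_trace f" "has_polynomial_trace g"
  shows "has_polynomial_trace (\<lambda>x. f x + g x)"
  unfolding has_polynomial_trace_def
proof
  fix q
  obtain Q R where "\<forall>t\<in>good. (\<Sum>x\<in>fibre_tuples t. f x *
     (\<Prod>i<m. poly (q i) (x i) * lagrange_weight (fibre t) (x i))) = poly Q t"
    "\<forall>t\<in>good. (\<Sum>x\<in>fibre_tuples t. g x *
     (\<Prod>i<m. poly (q i) (x i) * lagrange_weight (fibre t) (x i))) = poly R t"
    using assms unfolding has_polynomial_trace_def by blast
  then show "\<exists>Q. \<forall>t\<in>good. (\<Sum>x\<in>fibre_tuples t. (f x + g x) *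
     (\<Prod>i<m. poly (q i) (x i) * lagrange_weight (fibre t) (x i))) = poly Q t"
    by (intro exI[of _ "Q + R"]) (simp add: distrib_right sum.distrib)
qed

lemma has_polynomial_trace_cmult:
  assumes "has_polynomial_trace f"
  shows "has_polynomial_trace (\<lambda>x. c * f x)"
  using has_polynomial_trace_mult_poly[OF assms m_pos, of "[:c:]"] by simp

lemma has_polynomial_trace_sum:
  assumes "\<And>k. k \<in> K \<Longrightarrow> has_polynomial_trace (f k)"
  shows "has_polynomial_trace (\<lambda>x. \<Sum>k\<in>K. f k x)"
  using assms
proof (induction K rule: infinite_finite_induct)
  case (insert k K)
  then have "has_polynomial_trace (\<lambda>x. f k x + (\<Sum>k\<in>K. f k x))"
    by (intro has_polynomial_trace_add) simp_all
  with insert show ?case by simp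
qed (simp_all add: has_polynomial_trace_const)

lemma has_polynomial_trace_mult_diff:
  assumes "has_polynomial_trace f" "i < m" "j < m"
  shows "has_polynomial_trace (\<lambda>x. (x i - x j) * f x)"
proof -
  have "has_polynomial_trace (\<lambda>x. poly [:0, 1:] (x i) * f x + poly [:0, -1:] (x j) * f x)"
    by (intro has_polynomial_trace_add has_polynomial_trace_mult_poly assms)
  then show ?thesis by (simp add: left_diff_distrib)
qed

lemma has_polynomial_trace_mult_prod_diff:
  assumes "has_polynomial_trace f" "finite K" "K \<subseteq> {..<m} \<times> {..<m}"
  shows "has_polynomial_trace (\<lambda>x. (\<Prod>(i, j)\<in>K. x i - x j) * f x)"
  using assms(2,3)
proof (induction K)
  case (insert k K)
  then have "has_polynomial_trace (\<lambda>x. (x (fst k) - x (snd k)) * ((\<Prod>(i, j)\<in>K. x i - x j) * f x))"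
    by (intro has_polynomial_trace_mult_diff) auto
  with insert show ?case by (simp add: case_prod_unfold mult.assoc)
qed (simp add: assms(1))

lemma has_polynomial_trace_prod_poly:
  assumes "finite K" "\<And>v. v \<in> K \<Longrightarrow> \<iota> v < m"
  shows "has_polynomial_trace (\<lambda>x. \<Prod>v\<in>K. poly (p v) (x (\<iota> v)))"
  using assms
proof (induction K)
  case (insert v K)
  then have "has_polynomial_trace (\<lambda>x. poly (p v) (x (\<iota> v)) * (\<Prod>v\<in>K. poly (p v) (x (\<iota> v))))"
    by (intro has_polynomial_trace_mult_poly) simp_all
  with insert show ?case by simp
qed (simp add: has_polynomial_trace_const)

text \<open>With Lagrange basis polynomials of \<open>fibre t\<close> as test polynomials, the trace
  at \<open>t\<close> collapses to a nonzero multiple of \<open>f x\<close>. As a polynomial in the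
  parameter it has infinitely many zeros, so it is 0.\<close>

lemma trace_vanishing:
  assumes f: "has_polynomial_trace f" and I: "infinite I" "I \<subseteq> good"
    and van: "\<And>t x. t \<in> I \<Longrightarrow> x \<in> fibre_tuples t \<Longrightarrow> f x = 0"
    and t: "t \<in> good" and x: "x \<in> fibre_tuples t"
  shows "f x = 0"
proof -
  let ?w = "lagrange_weight (fibre t)"
  \<comment> \<open>These polynomials are built from the fixed \<open>t\<close> and
    \<open>x\<close>; they do not move with the parameter \<open>s\<close> below.\<close>
  define q where "q i = lagrange_basis (fibre t) (x i)" for i
  obtain Q where Q: "\<And>s. s \<in> good \<Longrightarrow> (\<Sum>y\<in>fibre_tuples s. f y *
     (\<Prod>i<m. poly (q i) (y i) * lagrange_weight (fibre s) (y i))) = poly Q s"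
    using f unfolding has_polynomial_trace_def by blast
  have "poly Q s = 0" if "s \<in> I" for s
    using Q[of s] van[OF that] that I(2) by (auto intro: sum.neutral)
  then have "Q = 0"
    using I(1) poly_roots_finite[of Q] finite_subset[of I "{s. poly Q s = 0}"] by auto
  then have "0 = (\<Sum>y\<in>fibre_tuples t. f y * (\<Prod>i<m. poly (q i) (y i) * ?w (y i)))"
    using Q[OF t] by simp
  also have "\<dots> = (\<Sum>y\<in>fibre_tuples t. if y = x then f x * (\<Prod>i<m. ?w (x i)) else 0)"
  proof (intro sum.cong refl)
    fix y assume y: "y \<in> fibre_tuples t"
    have val: "poly (q i) (y i) = (if y i = x i then 1 else 0)" if "i < m" for i
      unfolding q_def using x y that by (intro poly_lagrange_basis finite_fibre) auto
    show "f y * (\<Prod>i<m. poly (q i) (y i) * ?w (y i)) =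
        (if y = x then f x * (\<Prod>i<m. ?w (x i)) else 0)"
    proof (cases "y = x")
      case True
      then show ?thesis using val by simp
    next
      case False
      then obtain i where "i < m" "y i \<noteq> x i"
        using x y by (metis PiE_ext lessThan_iff)
      then show ?thesis using val[of i] False by (auto intro!: bexI[of _ i])
    qed
  qed
  also have "\<dots> = f x * (\<Prod>i<m. ?w (x i))"
    using x finite_PiE[of "{..<m}" "\<lambda>_. fibre t"] finite_fibre by simp
  finally show ?thesis
    using lagrange_weight_nonzero[OF finite_fibre] by auto
qed

text \<open>Multiplying \<open>f\<close> by the product of all differences of coordinates makes it
  vanish on tuples with repetitions, and changes it by a nonzero factor on the others.\<close>

lemma trace_vanishing_distinct:
  assumes f: "has_polynomial_trace f" and I: "infinite I" "I \<subseteq> good"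
    and van: "\<And>t x. t \<in> I \<Longrightarrow> x \<in> fibre_tuples t \<Longrightarrow> inj_on x {..<m} \<Longrightarrow> f x = 0"
    and t: "t \<in> good" and x: "x \<in> fibre_tuples t" "inj_on x {..<m}"
  shows "f x = 0"
proof -
  let ?K = "{(i, j). i < m \<and> j < m \<and> i \<noteq> j}"
  have K: "finite ?K" "?K \<subseteq> {..<m} \<times> {..<m}"
    by (auto intro: finite_subset[of _ "{..<m} \<times> {..<m}"])
  have inj: "(\<Prod>(i, j)\<in>?K. y i - y j) \<noteq> 0 \<longleftrightarrow> inj_on y {..<m}" for y :: "nat \<Rightarrow> complex"
    using K(1) by (auto simp: inj_on_def)
  have "(\<Prod>(i, j)\<in>?K. x i - x j) * f x = 0"
  proof (rule trace_vanishing[OF has_polynomial_trace_mult_prod_diff[OF f K] I _ t x(1)])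
    fix s y assume "s \<in> I" "y \<in> fibre_tuples s"
    then show "(\<Prod>(i, j)\<in>?K. y i - y j) * f y = 0"
      using van[of s y] inj[of y] by auto
  qed
  then show ?thesis using inj[of x] x(2) by simp
qed

end

section \<open>Irreducibility, dimension and closed sets of symmetric products\<close>

text \<open>If two closed sets cover the image, one of them contains \<open>h t\<close> for
  infinitely many \<open>t\<close>, and the dichotomy makes it everything.\<close>

lemma irreducible_space_image:
  assumes G: "infinite G" "h ` G \<subseteq> topspace X"
    and dichotomy: "\<And>Z. closedin X Z \<Longrightarrow> infinite {t \<in> G. h t \<in> Z} \<Longrightarrow> h ` G \<subseteq> Z"
  shows "irreducible_space (subtopology X (h ` G))"
proof -
  have top: "topspace (subtopology X (h ` G)) = h ` G" using G(2) by auto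
  show ?thesis
    unfolding irreducible_space_def top
  proof (intro conjI allI impI)
    show "h ` G \<noteq> {}" using G(1) by auto
    fix C D
    assume CD: "closedin (subtopology X (h ` G)) C \<and> closedin (subtopology X (h ` G)) D \<and> C \<union> D = h ` G"
    then obtain C' D' where C': "closedin X C'" "C = C' \<inter> h ` G"
      and D': "closedin X D'" "D = D' \<inter> h ` G"
      by (auto simp: closedin_subtopology)
    have "G = {t \<in> G. h t \<in> C'} \<union> {t \<in> G. h t \<in> D'}" using CD C'(2) D'(2) by blast
    then have "infinite {t \<in> G. h t \<in> C'} \<or> infinite {t \<in> G. h t \<in> D'}"
      using G(1) finite_UnI by metis
    then have "h ` G \<subseteq> C' \<or> h ` G \<subseteq> D'"
      using dichotomy[OF C'(1)] dichotomy[OF D'(1)] by blast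
    then show "C = h ` G \<or> D = h ` G" using C'(2) D'(2) by blast
  qed
qed

lemma irreducible_space_singleton:
  assumes "topspace X = {a}" shows "irreducible_space X"
  unfolding irreducible_space_def assms by blast

text \<open>The chain of length 1 is \<open>{a}\<close> inside the whole space.\<close>

lemma krull_dim_ge_1:
  assumes "irreducible_space X" "closedin X {a}" "topspace X \<noteq> {a}"
  shows "krull_dim X \<ge> 1"
proof -
  define Z where "Z i = (if i = 0 then {a} else topspace X)" for i :: nat
  have a: "a \<in> topspace X" using closedin_subset[OF assms(2)] by simp
  have "closedin X (Z i) \<and> irreducible_space (subtopology X (Z i))" for i
    using assms(1,2) a by (auto simp: Z_def intro!: irreducible_space_singleton[where a = a])
  moreover have "Z i \<subset> Z (Suc i)" if "i < 1" for i
    using that a assms(3) by (auto simp: Z_def)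
  ultimately have "enat 1 \<in> {enat k | k. \<exists>Z :: nat \<Rightarrow> _ set.
      (\<forall>i\<le>k. closedin X (Z i) \<and> irreducible_space (subtopology X (Z i))) \<and>
      (\<forall>i<k. Z i \<subset> Z (Suc i))}"
    by blast
  then show ?thesis unfolding krull_dim_def one_enat_def by (rule Sup_upper)
qed

lemma topspace_sym_product:
  assumes "\<Gamma> \<subseteq> proj_space n"
  shows "topspace (sym_product n m \<Gamma>) = mset ` {xs. length xs = m \<and> set xs \<subseteq> \<Gamma>}"
proof -
  have "proj_tuples n m \<inter> {xs. length xs = m \<and> set xs \<subseteq> \<Gamma>} = {xs. length xs = m \<and> set xs \<subseteq> \<Gamma>}"
    using assms by (auto simp: proj_tuples_def)
  then show ?thesis by (simp add: sym_product_def)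
qed

text \<open>A set of multisets is closed iff its preimage among the ordered lists is cut out by
  multihomogeneous forms; this unfolds the quotient and the subspace topology.\<close>

lemma closedin_sym_product_iff:
  assumes \<Gamma>: "\<Gamma> \<subseteq> proj_space n"
  shows "closedin (sym_product n m \<Gamma>) Z \<longleftrightarrow>
    Z \<subseteq> mset ` {xs. length xs = m \<and> set xs \<subseteq> \<Gamma>} \<and>
    (\<exists>S\<subseteq>multiforms n m. \<forall>xs. length xs = m \<and> set xs \<subseteq> \<Gamma> \<longrightarrow>
       (mset xs \<in> Z \<longleftrightarrow> (\<forall>p\<in>S. vanishes_at n p xs)))"
proof -
  let ?L = "{xs. length xs = m \<and> set xs \<subseteq> \<Gamma>}"
  let ?X = "subtopology (zariski_product n m) ?L"
  have L: "?L \<subseteq> proj_tuples n m" using \<Gamma> by (auto simp: proj_tuples_def)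
  then have top: "topspace ?X = ?L" by auto
  have "closedin (sym_product n m \<Gamma>) Z \<longleftrightarrow>
      Z \<subseteq> mset ` ?L \<and> openin ?X {xs \<in> ?L. mset xs \<in> mset ` ?L - Z}"
    unfolding closedin_def topspace_sym_product[OF \<Gamma>]
    by (auto simp: sym_product_def openin_quotient_topology top simp del: topspace_subtopology)
  also have "{xs \<in> ?L. mset xs \<in> mset ` ?L - Z} = ?L - {xs \<in> ?L. mset xs \<in> Z}" by auto
  also have "openin ?X (?L - {xs \<in> ?L. mset xs \<in> Z}) \<longleftrightarrow> closedin ?X {xs \<in> ?L. mset xs \<in> Z}"
    unfolding closedin_def top by auto
  also have "\<dots> \<longleftrightarrow> (\<exists>S\<subseteq>multiforms n m. {xs \<in> ?L. mset xs \<in> Z} = zero_locus n m S \<inter> ?L)"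
    unfolding closedin_subtopology closedin_zariski_product by blast
  also have "\<dots> \<longleftrightarrow> (\<exists>S\<subseteq>multiforms n m. \<forall>xs. xs \<in> ?L \<longrightarrow>
       (mset xs \<in> Z \<longleftrightarrow> (\<forall>p\<in>S. vanishes_at n p xs)))"
    using L unfolding zero_locus_def set_eq_iff by (intro ex_cong1 conj_cong refl) blast
  finally show ?thesis by simp
qed

section \<open>Multihomogeneous forms\<close>

text \<open>The multidegree, existentially quantified in \<open>multiforms\<close>, is fixed here so
  that sums and differences stay inside the set.\<close>

definition multidegree_forms :: "nat \<Rightarrow> nat \<Rightarrow> (nat \<Rightarrow> nat) \<Rightarrow> (nat \<times> nat) cpoly set" where
  "multidegree_forms n m d = {p. \<forall>\<mu>\<in>Poly_Mapping.keys p. Poly_Mapping.keys \<mu> \<subseteq> {..<m} \<times> {..n} \<and>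
      (\<forall>i<m. (\<Sum>j\<le>n. Poly_Mapping.lookup \<mu> (i, j)) = d i)}"

lemma multiforms_iff: "p \<in> multiforms n m \<longleftrightarrow> (\<exists>d. p \<in> multidegree_forms n m d)"
  by (simp add: multiforms_def multidegree_forms_def)

lemma multidegree_forms_0 [simp]: "0 \<in> multidegree_forms n m d"
  by (simp add: multidegree_forms_def)

lemma multidegree_forms_const: "Poly_Mapping.single 0 c \<in> multidegree_forms n m (\<lambda>_. 0)"
  by (simp add: multidegree_forms_def)

lemma multidegree_forms_add:
  "p \<in> multidegree_forms n m d \<Longrightarrow> q \<in> multidegree_forms n m d \<Longrightarrow> p + q \<in> multidegree_forms n m d"
  using Poly_Mapping.keys_add[of p q] unfolding multidegree_forms_def by blast

lemma multidegree_forms_sum: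
  "(\<And>k. k \<in> K \<Longrightarrow> p k \<in> multidegree_forms n m d) \<Longrightarrow> (\<Sum>k\<in>K. p k) \<in> multidegree_forms n m d"
  by (induction K rule: infinite_finite_induct) (simp_all add: multidegree_forms_add)

lemma multidegree_forms_mult:
  assumes "p \<in> multidegree_forms n m d" "q \<in> multidegree_forms n m e"
  shows "p * q \<in> multidegree_forms n m (\<lambda>i. d i + e i)"
  unfolding multidegree_forms_def mem_Collect_eq
proof
  fix \<mu> assume "\<mu> \<in> Poly_Mapping.keys (p * q)"
  with keys_mult[of p q] obtain \<alpha> \<beta> where
    "\<mu> = \<alpha> + \<beta>" "\<alpha> \<in> Poly_Mapping.keys p" "\<beta> \<in> Poly_Mapping.keys q" by blast
  then show "Poly_Mapping.keys \<mu> \<subseteq> {..<m} \<times> {..n} \<and>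
      (\<forall>i<m. (\<Sum>j\<le>n. Poly_Mapping.lookup \<mu> (i, j)) = d i + e i)"
    using assms Poly_Mapping.keys_add[of \<alpha> \<beta>] unfolding multidegree_forms_def
    by (fastforce simp: lookup_add sum.distrib)
qed

lemma multidegree_forms_scale:
  "p \<in> multidegree_forms n m d \<Longrightarrow> scale_poly c p \<in> multidegree_forms n m d"
  using multidegree_forms_mult[OF multidegree_forms_const] by (fastforce simp: scale_poly_def)

lemma multidegree_forms_diff:
  "p \<in> multidegree_forms n m d \<Longrightarrow> q \<in> multidegree_forms n m d \<Longrightarrow> p - q \<in> multidegree_forms n m d"
  using multidegree_forms_add[of p n m d "- q"] by (simp add: multidegree_forms_def)

lemma multiforms_prod:
  "(\<And>k. k \<in> K \<Longrightarrow> p k \<in> multiforms n m) \<Longrightarrow> (\<Prod>k\<in>K. p k) \<in> multiforms n m"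
proof (induction K rule: infinite_finite_induct)
  case (insert k K)
  then show ?case by (simp add: multiforms_mult)
qed (auto simp: multiforms_def)

lemma poly_eval_scale: "poly_eval x (scale_poly c p) = c * poly_eval x p"
  by (simp add: scale_poly_def poly_eval_mult poly_eval_single mono_eval_def)

lemma poly_eval_diff: "poly_eval x (p - q) = poly_eval x p - poly_eval x q"
  using poly_eval_add[of x "p - q" q] by simp

lemma poly_eval_one: "poly_eval x 1 = 1"
  by (simp add: poly_eval_def)

lemma poly_eval_prod: "poly_eval x (\<Prod>k\<in>K. p k) = (\<Prod>k\<in>K. poly_eval x (p k))"
  by (induction K rule: infinite_finite_induct) (auto simp: poly_eval_mult poly_eval_one)

definition factor_linear_form :: "nat \<Rightarrow> nat \<Rightarrow> (nat \<Rightarrow> complex) \<Rightarrow> (nat \<times> nat) cpoly" where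
  "factor_linear_form n i c = (\<Sum>j\<le>n. Poly_Mapping.single (Poly_Mapping.single (i, j) 1) (c j))"

lemma poly_eval_factor_linear_form: "poly_eval x (factor_linear_form n i c) = (\<Sum>j\<le>n. c j * x (i, j))"
  by (simp add: factor_linear_form_def poly_eval_sum poly_eval_single mono_eval_def)

lemma factor_linear_form_multidegree:
  assumes "i < m"
  shows "factor_linear_form n i c \<in> multidegree_forms n m (\<lambda>k. if k = i then 1 else 0)"
  unfolding factor_linear_form_def
proof (rule multidegree_forms_sum)
  fix j assume j: "j \<in> {..n}"
  have "(\<Sum>j'\<le>n. Poly_Mapping.lookup (Poly_Mapping.single (i, j) 1) (k, j')) =
      (if k = i then 1 else (0 :: nat))" for k
    using j by (auto simp: lookup_single when_def sum.delta)
  then show "Poly_Mapping.single (Poly_Mapping.single (i, j) 1) (c j) \<in>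
      multidegree_forms n m (\<lambda>k. if k = i then 1 else 0)"
    using assms j by (auto simp: multidegree_forms_def)
qed

text \<open>Invariance under reordering makes the condition on a multiset independent of the list
  that represents it, so the locus of \<open>S\<close> descends to the quotient.\<close>

lemma closedin_sym_productI:
  assumes \<Gamma>: "\<Gamma> \<subseteq> proj_space n" and S: "S \<subseteq> multiforms n m"
    and inv: "\<And>xs ys. mset xs = mset ys \<Longrightarrow> cond xs \<longleftrightarrow> cond ys"
    and cond: "\<And>xs. length xs = m \<Longrightarrow> set xs \<subseteq> \<Gamma> \<Longrightarrow> cond xs \<longleftrightarrow> (\<forall>p\<in>S. vanishes_at n p xs)"
  shows "closedin (sym_product n m \<Gamma>) (mset ` {xs. length xs = m \<and> set xs \<subseteq> \<Gamma> \<and> cond xs})"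
  unfolding closedin_sym_product_iff[OF \<Gamma>]
proof (intro conjI exI[of _ S] S allI impI)
  fix xs assume xs: "length xs = m \<and> set xs \<subseteq> \<Gamma>"
  have "mset xs \<in> mset ` {xs. length xs = m \<and> set xs \<subseteq> \<Gamma> \<and> cond xs} \<longleftrightarrow> cond xs"
  proof
    assume "mset xs \<in> mset ` {xs. length xs = m \<and> set xs \<subseteq> \<Gamma> \<and> cond xs}"
    then obtain ys where "mset xs = mset ys" "cond ys" by blast
    then show "cond xs" using inv by blast
  qed (use xs in blast)
  then show "mset xs \<in> mset ` {xs. length xs = m \<and> set xs \<subseteq> \<Gamma> \<and> cond xs} \<longleftrightarrow>
      (\<forall>p\<in>S. vanishes_at n p xs)"
    using cond xs by simp
qed auto

lemma self_in_proj_point: "v \<in> proj_point v"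
  unfolding proj_point_def by (metis (mono_tags, lifting) mem_Collect_eq one_smult_vec)

section \<open>Affine charts of rational normal curves\<close>

text \<open>The polynomials \<open>q j\<close> are the coordinates of an affine parametrization of
  the curve, and \<open>w\<close> represents the one point it misses. The linear form with
  coefficients \<open>l a\<close> restricts to the monomial \<open>x ^ a\<close>, so
  \<open>l 0\<close> is 1 on the chart and 0 at infinity.\<close>

locale rational_chart =
  fixes n :: nat and q :: "nat \<Rightarrow> complex poly" and l :: "nat \<Rightarrow> nat \<Rightarrow> complex"
    and w :: "complex vec"
  assumes n_pos: "1 \<le> n"
    and degree_q: "\<And>j. j \<le> n \<Longrightarrow> degree (q j) \<le> n"
    and dual: "\<And>a x. a \<le> n \<Longrightarrow> (\<Sum>j\<le>n. l a j * poly (q j) x) = x ^ a"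
    and w: "w \<in> carrier_vec (n + 1)" "w \<noteq> 0\<^sub>v (n + 1)" "(\<Sum>j\<le>n. l 0 j * w $ j) = 0"
begin

definition chart :: "complex \<Rightarrow> complex vec" where
  "chart x = vec (n + 1) (\<lambda>j. poly (q j) x)"

definition pt :: "complex \<Rightarrow> complex vec set" where
  "pt x = proj_point (chart x)"

definition infinity :: "complex vec set" where
  "infinity = proj_point w"

definition curve :: "complex vec set set" where
  "curve = insert infinity (range pt)"

lemma chart_index [simp]: "j \<le> n \<Longrightarrow> chart x $ j = poly (q j) x"
  by (simp add: chart_def)

lemma chart_carrier [simp]: "chart x \<in> carrier_vec (n + 1)"
  by (simp add: chart_def)

lemma dual_chart: "a \<le> n \<Longrightarrow> (\<Sum>j\<le>n. l a j * chart x $ j) = x ^ a"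
  by (simp add: dual)

lemma dual_smult:
  assumes "u = c \<cdot>\<^sub>v v" "v \<in> carrier_vec (n + 1)"
  shows "(\<Sum>j\<le>n. l a j * u $ j) = c * (\<Sum>j\<le>n. l a j * v $ j)"
  using assms by (simp add: sum_distrib_left mult_ac)

lemma chart_nonzero: "chart x \<noteq> 0\<^sub>v (n + 1)"
proof
  assume "chart x = 0\<^sub>v (n + 1)"
  then have "(\<Sum>j\<le>n. l 0 j * chart x $ j) = 0" by simp
  then show False using dual_chart[of 0 x] by simp
qed

lemma pt_in_proj_space: "pt x \<in> proj_space n"
  using chart_nonzero chart_carrier unfolding pt_def proj_space_def by blast

lemma curve_subset: "curve \<subseteq> proj_space n"
  using w pt_in_proj_space by (auto simp: curve_def infinity_def proj_space_def)

lemma inj_pt: "inj pt"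
proof
  fix x y assume "pt x = pt y"
  then have "chart x \<in> proj_point (chart y)" using self_in_proj_point[of "chart x"] by (simp add: pt_def)
  then obtain c where c: "chart x = c \<cdot>\<^sub>v chart y" by (auto simp: proj_point_def)
  have "x ^ a = c * y ^ a" if "a \<le> n" for a
    using dual_smult[OF c chart_carrier, of a] dual_chart[OF that] by simp
  \<comment> \<open>The exponent 0 gives \<open>c = 1\<close>; the exponent 1 is available because
    \<open>n \<ge> 1\<close>.\<close>
  from this[of 0] this[of 1] show "x = y" using n_pos by simp
qed

lemma infinity_not_pt: "infinity \<noteq> pt x"
proof
  assume "infinity = pt x"
  then have "chart x \<in> proj_point w" using self_in_proj_point by (simp add: pt_def infinity_def)
  then obtain c where c: "chart x = c \<cdot>\<^sub>v w" by (auto simp: proj_point_def)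
  show False using dual_smult[OF c w(1), of 0] dual_chart[of 0 x] w(3) by simp
qed

text \<open>One fixed coordinate vector for each point of the curve, so that vanishing of a form is
  tested by a single evaluation.\<close>

definition rep :: "complex vec set \<Rightarrow> complex vec" where
  "rep P = (if P = infinity then w else chart (inv_into UNIV pt P))"

lemma rep_pt [simp]: "rep (pt x) = chart x"
  using infinity_not_pt[of x] by (auto simp: rep_def inv_into_f_f[OF inj_pt])

lemma rep_infinity [simp]: "rep infinity = w"
  by (simp add: rep_def)

lemma rep_in:
  assumes "P \<in> curve" shows "rep P \<in> P - {0\<^sub>v (n + 1)}"
proof (cases "P = infinity")
  case True
  then have "rep P = w" "P = proj_point w" by (simp_all add: infinity_def rep_def)
  then show ?thesis using w(2) self_in_proj_point[of w] by simp
next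
  case False
  with assms obtain x where x: "P = pt x" by (auto simp: curve_def)
  then have "rep P = chart x" by simp
  moreover have "P = proj_point (chart x)" using x by (simp add: pt_def)
  ultimately show ?thesis using chart_nonzero[of x] self_in_proj_point[of "chart x"] by simp
qed

section \<open>Values of multihomogeneous forms along the curve\<close>

lemma vanishes_at_rep:
  assumes "p \<in> multiforms n m" "length xs = m" "set xs \<subseteq> curve"
  shows "vanishes_at n p xs \<longleftrightarrow> poly_eval (\<lambda>(i, j). rep (xs ! i) $ j) p = 0"
proof (rule vanishes_at_iff[OF assms(1)])
  show "xs \<in> proj_tuples n m" using assms curve_subset by (auto simp: proj_tuples_def)
  show "rep (xs ! i) \<in> xs ! i - {0\<^sub>v (n + 1)}" if "i < m" for i
    using that assms(2,3) nth_mem by (intro rep_in) blast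
qed

definition dual_form :: "nat \<Rightarrow> nat \<Rightarrow> (nat \<times> nat) cpoly" where
  "dual_form i a = factor_linear_form n i (l a)"

definition dual_value :: "complex vec set \<Rightarrow> nat \<Rightarrow> complex" where
  "dual_value P a = (\<Sum>j\<le>n. l a j * rep P $ j)"

lemma poly_eval_dual_form:
  "poly_eval (\<lambda>(i, j). rep (xs ! i) $ j) (dual_form i a) = dual_value (xs ! i) a"
  by (simp add: dual_form_def poly_eval_factor_linear_form dual_value_def)

lemma dual_value_pt: "a \<le> n \<Longrightarrow> dual_value (pt x) a = x ^ a"
  by (simp add: dual_value_def dual)

lemma dual_value_infinity: "dual_value infinity 0 = 0"
  by (simp add: dual_value_def w)

text \<open>On the chart a cubic form restricts to a polynomial of degree at most \<open>3 * n\<close>, and every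
  monomial \<open>x ^ k\<close> with \<open>k \<le> 3 * n\<close> is a product of three powers of exponent at most \<open>n\<close>.\<close>

definition cubic_form :: "nat \<Rightarrow> complex poly \<Rightarrow> (nat \<times> nat) cpoly" where
  "cubic_form i g = (\<Sum>k\<le>3 * n. scale_poly (coeff g k)
     (dual_form i (min k n) * dual_form i (min (k - n) n) * dual_form i (k - 2 * n)))"

definition cubic_value :: "complex poly \<Rightarrow> complex vec set \<Rightarrow> complex" where
  "cubic_value g P = (\<Sum>k\<le>3 * n. coeff g k *
     (dual_value P (min k n) * dual_value P (min (k - n) n) * dual_value P (k - 2 * n)))"

lemma poly_eval_cubic_form:
  "poly_eval (\<lambda>(i, j). rep (xs ! i) $ j) (cubic_form i g) = cubic_value g (xs ! i)"
  by (simp add: cubic_form_def cubic_value_def poly_eval_sum poly_eval_scale poly_eval_mult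
      poly_eval_dual_form)

lemma cubic_value_pt:
  assumes "degree g \<le> 3 * n"
  shows "cubic_value g (pt x) = poly g x"
proof -
  have "dual_value (pt x) (min k n) * dual_value (pt x) (min (k - n) n) *
      dual_value (pt x) (k - 2 * n) = x ^ k" if "k \<le> 3 * n" for k
  proof -
    \<comment> \<open>The subtractions are truncated: the three exponents fill up one after the
      other, each with capacity \<open>n\<close>.\<close>
    have "min k n + min (k - n) n + (k - 2 * n) = k" by linarith
    moreover have "k - 2 * n \<le> n" using that by linarith
    ultimately show ?thesis by (simp add: dual_value_pt flip: power_add)
  qed
  then have "cubic_value g (pt x) = (\<Sum>k\<le>3 * n. coeff g k * x ^ k)"
    by (simp add: cubic_value_def)
  also have "\<dots> = (\<Sum>k\<le>degree g. coeff g k * x ^ k)"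
    using assms by (intro sum.mono_neutral_right) (auto simp: coeff_eq_0)
  finally show ?thesis by (simp add: poly_altdef)
qed

lemma dual_form_multidegree:
  "i < m \<Longrightarrow> dual_form i a \<in> multidegree_forms n m (\<lambda>k. if k = i then 1 else 0)"
  unfolding dual_form_def by (rule factor_linear_form_multidegree)

lemma cubic_form_multidegree:
  assumes "i < m"
  shows "cubic_form i g \<in> multidegree_forms n m (\<lambda>k. if k = i then 3 else 0)"
  unfolding cubic_form_def
proof (intro multidegree_forms_sum multidegree_forms_scale)
  fix k
  have e: "(\<lambda>k. if k = i then 3 else 0) = (\<lambda>k. (if k = i then 1 else 0) + (if k = i then 1 else 0) +
      (if k = i then 1 else (0 :: nat)))"
    by auto
  show "dual_form i (min k n) * dual_form i (min (k - n) n) * dual_form i (k - 2 * n) \<in>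
      multidegree_forms n m (\<lambda>k. if k = i then 3 else 0)"
    unfolding e by (intro multidegree_forms_mult dual_form_multidegree assms)
qed

text \<open>The first product vanishes when some point is at infinity. On affine points the second
  is the Vandermonde product, as each factor becomes a difference of two parameters.\<close>

definition degeneracy_form :: "nat \<Rightarrow> (nat \<times> nat) cpoly" where
  "degeneracy_form m = (\<Prod>i<m. dual_form i 0) * (\<Prod>(i, j)\<in>{(i, j). i < j \<and> j < m}.
     dual_form i 0 * dual_form j 1 - dual_form j 0 * dual_form i 1)"

lemma degeneracy_form_multiforms: "degeneracy_form m \<in> multiforms n m"
  unfolding degeneracy_form_def
proof (intro multiforms_mult multiforms_prod)
  show "dual_form i 0 \<in> multiforms n m" if "i \<in> {..<m}" for i
    using that dual_form_multidegree multiforms_iff by blast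
  fix k assume "k \<in> {(i, j). i < j \<and> j < m}"
  then obtain i j where k: "k = (i, j)" "i < m" "j < m" by auto
  have "dual_form i 0 * dual_form j 1 - dual_form j 0 * dual_form i 1 \<in>
      multidegree_forms n m (\<lambda>k. (if k = i then 1 else 0) + (if k = j then 1 else 0))"
    unfolding mult.commute[of "dual_form j 0"]
    by (intro multidegree_forms_diff multidegree_forms_mult dual_form_multidegree k)
  then show "(case k of (i, j) \<Rightarrow> dual_form i 0 * dual_form j 1 -
      dual_form j 0 * dual_form i 1) \<in> multiforms n m"
    unfolding k multiforms_iff by auto
qed

lemma map_pt_of_curve_list:
  assumes "set xs \<subseteq> curve" "infinity \<notin> set xs"
  obtains ys where "xs = map pt ys"
proof -
  have "set xs \<subseteq> range pt" using assms by (auto simp: curve_def)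
  then have "xs \<in> lists (range pt)" by auto
  then show thesis using that by (auto simp: lists_image)
qed

lemma vanishes_at_degeneracy_form:
  assumes "length xs = m" "set xs \<subseteq> curve"
  shows "vanishes_at n (degeneracy_form m) xs \<longleftrightarrow> infinity \<in> set xs \<or> \<not> distinct xs"
proof -
  have K: "finite {(i, j). i < j \<and> j < m}"
    by (rule finite_subset[of _ "{..<m} \<times> {..<m}"]) auto
  have v: "vanishes_at n (degeneracy_form m) xs \<longleftrightarrow> (\<exists>i<m. dual_value (xs ! i) 0 = 0) \<or>
      (\<exists>i j. i < j \<and> j < m \<and> dual_value (xs ! i) 0 * dual_value (xs ! j) 1 =
         dual_value (xs ! j) 0 * dual_value (xs ! i) 1)"
    unfolding vanishes_at_rep[OF degeneracy_form_multiforms assms]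
    using K by (auto simp: degeneracy_form_def poly_eval_mult poly_eval_prod poly_eval_diff
        poly_eval_dual_form)
  show ?thesis
  proof (cases "infinity \<in> set xs")
    case True
    then show ?thesis using v dual_value_infinity assms(1) by (auto simp: in_set_conv_nth)
  next
    case False
    then obtain ys where ys: "xs = map pt ys" using map_pt_of_curve_list assms(2) by blast
    then have len: "length ys = m" using assms by simp
    have val: "dual_value (xs ! i) 0 = 1" "dual_value (xs ! i) (Suc 0) = ys ! i" if "i < m" for i
      using that len n_pos by (simp_all add: ys dual_value_pt)
    have "vanishes_at n (degeneracy_form m) xs \<longleftrightarrow> (\<exists>j<m. \<exists>i<j. ys ! j = ys ! i)"
      unfolding v by (fastforce simp: val)
    also have "\<dots> \<longleftrightarrow> \<not> distinct ys"
    proof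
      assume "\<not> distinct ys"
      then obtain i j where ij: "i < m" "j < m" "i \<noteq> j" "ys ! i = ys ! j"
        unfolding distinct_conv_nth len by blast
      consider "i < j" | "j < i" using ij(3) by linarith
      then show "\<exists>j<m. \<exists>i<j. ys ! j = ys ! i"
      proof cases
        case 1
        with ij show ?thesis by (intro exI[of _ j] conjI exI[of _ i]) simp_all
      next
        case 2
        with ij show ?thesis by (intro exI[of _ i] conjI exI[of _ j]) simp_all
      qed
    next
      assume "\<exists>j<m. \<exists>i<j. ys ! j = ys ! i"
      then obtain i j where ij: "j < m" "i < j" "ys ! j = ys ! i" by blast
      then have "i < m" "i \<noteq> j" by simp_all
      with ij show "\<not> distinct ys" unfolding distinct_conv_nth len by metis
    qed
    also have "\<dots> \<longleftrightarrow> \<not> distinct xs"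
      unfolding ys by (simp add: distinct_map inj_on_subset[OF inj_pt])
    finally show ?thesis using False by simp
  qed
qed

end

section \<open>The family cut out by a pencil\<close>

text \<open>The bound on \<open>m\<close> makes \<open>g0\<close> and \<open>g1\<close> restrictions
  of cubic forms to the curve.\<close>

locale chart_pencil = rational_chart n q l w + polynomial_pencil g0 g1 m
  for n q l w g0 g1 m +
  assumes m_le: "m \<le> 3 * n"
begin

definition family :: "complex vec set set set" where
  "family = (\<lambda>t. pt ` fibre t) ` good"

abbreviation point :: "complex \<Rightarrow> complex vec set multiset" where
  "point t \<equiv> mset_set (pt ` fibre t)"

lemma cubic_value_generators:
  "cubic_value g0 (pt x) = poly g0 x" "cubic_value g1 (pt x) = poly g1 x"
  using m_le deg_g0 deg_g1 by (simp_all add: cubic_value_pt)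

lemma card_pt_image: "card (pt ` Y) = card Y"
  by (rule card_image[OF inj_on_subset[OF inj_pt]]) simp

lemma mset_map_pt:
  assumes "distinct ys" "set ys = fibre t"
  shows "mset (map pt ys) = point t"
proof -
  have "distinct (map pt ys)" using assms(1) by (simp add: distinct_map inj_on_subset[OF inj_pt])
  then have "mset_set (set (map pt ys)) = mset (map pt ys)" by (rule mset_set_set)
  then show ?thesis using assms by simp
qed

lemma fibre_list:
  assumes "t \<in> good"
  obtains ys where "distinct ys" "set ys = fibre t" "length ys = m"
proof -
  obtain ys where ys: "set ys = fibre t" "distinct ys"
    using finite_distinct_list[OF finite_fibre[of t]] by blast
  then have "length ys = m" using distinct_card[of ys] assms by (simp add: good_def)
  with ys show thesis using that by blast
qed

lemma pt_curve: "pt x \<in> curve"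
  by (simp add: curve_def)

lemma map_pt_curve: "set (map pt ys) \<subseteq> curve"
  by (auto simp: curve_def)

definition degenerate :: "complex vec set multiset set" where
  "degenerate = mset ` {xs. length xs = m \<and> set xs \<subseteq> curve \<and> (infinity \<in> set xs \<or> \<not> distinct xs)}"

text \<open>Vanishing of the minors says that the pairs of values of \<open>g0\<close> and
  \<open>g1\<close> at the points are pairwise proportional. The homogeneous
  \<open>cubic_value\<close> also gives the condition a meaning at infinity.\<close>

definition incident :: "complex vec set multiset set" where
  "incident = mset ` {xs. length xs = m \<and> set xs \<subseteq> curve \<and> (\<forall>P\<in>set xs. \<forall>Q\<in>set xs.
     cubic_value g0 P * cubic_value g1 Q = cubic_value g0 Q * cubic_value g1 P)}"

lemma closedin_degenerate: "closedin (sym_product n m curve) degenerate"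
  unfolding degenerate_def
proof (rule closedin_sym_productI[OF curve_subset, of "{degeneracy_form m}"])
  fix xs ys :: "complex vec set list" assume "mset xs = mset ys"
  then show "(infinity \<in> set xs \<or> \<not> distinct xs) \<longleftrightarrow> (infinity \<in> set ys \<or> \<not> distinct ys)"
    using mset_eq_setD mset_eq_imp_distinct_iff by metis
qed (simp_all add: degeneracy_form_multiforms vanishes_at_degeneracy_form)

lemma closedin_incident: "closedin (sym_product n m curve) incident"
proof -
  define W where "W i j = cubic_form i g0 * cubic_form j g1 - cubic_form j g0 * cubic_form i g1" for i j
  have W: "W i j \<in> multiforms n m" if "i < m" "j < m" for i j
  proof -
    have "W i j \<in> multidegree_forms n m (\<lambda>k. (if k = i then 3 else 0) + (if k = j then 3 else 0))"
      unfolding W_def mult.commute[of "cubic_form j g0"]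
      by (intro multidegree_forms_diff multidegree_forms_mult cubic_form_multidegree that)
    then show ?thesis unfolding multiforms_iff by blast
  qed
  show ?thesis
    unfolding incident_def
  proof (rule closedin_sym_productI[OF curve_subset, of "{W i j | i j. i < m \<and> j < m}"])
    fix xs assume xs: "length xs = m" "set xs \<subseteq> curve"
    have "vanishes_at n (W i j) xs \<longleftrightarrow> cubic_value g0 (xs ! i) * cubic_value g1 (xs ! j) =
        cubic_value g0 (xs ! j) * cubic_value g1 (xs ! i)" if "i < m" "j < m" for i j
      unfolding vanishes_at_rep[OF W[OF that] xs]
      by (simp add: W_def poly_eval_diff poly_eval_mult poly_eval_cubic_form)
    then have "(\<forall>P\<in>set xs. \<forall>Q\<in>set xs.
        cubic_value g0 P * cubic_value g1 Q = cubic_value g0 Q * cubic_value g1 P) \<longleftrightarrow>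
        (\<forall>i<m. \<forall>j<m. vanishes_at n (W i j) xs)"
      using xs(1) by (simp add: all_set_conv_all_nth)
    then show "(\<forall>P\<in>set xs. \<forall>Q\<in>set xs.
        cubic_value g0 P * cubic_value g1 Q = cubic_value g0 Q * cubic_value g1 P) \<longleftrightarrow>
        (\<forall>p\<in>{W i j | i j. i < m \<and> j < m}. vanishes_at n p xs)"
      by blast
  qed (use W in \<open>auto dest: mset_eq_setD\<close>)
qed

text \<open>Off \<open>degenerate\<close>, a list consists of \<open>m\<close> distinct affine
  points, and there \<open>incident\<close> is the criterion of
  \<open>fibre_characterization\<close>. This exhibits the family as an open set intersected with a
  closed one.\<close>

lemma family_eq:
  "point ` good = (topspace (sym_product n m curve) - degenerate) \<inter> incident"
proof (intro equalityI subsetI)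
  fix M assume "M \<in> point ` good"
  then obtain t where t: "t \<in> good" and M: "M = point t" by blast
  obtain ys where ys: "distinct ys" "set ys = fibre t" "length ys = m" using fibre_list[OF t] .
  have M': "M = mset (map pt ys)" using mset_map_pt[OF ys(1,2)] M by simp
  have "distinct (map pt ys)" using ys(1) by (simp add: distinct_map inj_on_subset[OF inj_pt])
  moreover have "infinity \<notin> set (map pt ys)" using infinity_not_pt by auto
  ultimately have "M \<notin> degenerate"
  proof (intro notI)
    assume *: "distinct (map pt ys)" "infinity \<notin> set (map pt ys)" and "M \<in> degenerate"
    then obtain zs where zs: "mset (map pt ys) = mset zs" "infinity \<in> set zs \<or> \<not> distinct zs"
      unfolding M' degenerate_def by blast
    then show False
      using mset_eq_setD[OF zs(1)] mset_eq_imp_distinct_iff[OF zs(1)] * by metis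
  qed
  moreover have "M \<in> topspace (sym_product n m curve)"
    unfolding topspace_sym_product[OF curve_subset] M'
    by (intro imageI CollectI conjI) (simp_all only: length_map ys(3) map_pt_curve)
  moreover have "poly g0 x * poly g1 y = poly g0 y * poly g1 x" if "x \<in> fibre t" "y \<in> fibre t" for x y
  proof -
    have "poly g0 x = - t * poly g1 x" "poly g0 y = - t * poly g1 y"
      using that by (simp_all add: fibre_iff eq_neg_iff_add_eq_0)
    then show ?thesis by simp
  qed
  then have "M \<in> incident"
    unfolding incident_def M' using ys(2,3)
    by (intro imageI CollectI conjI) (simp_all add: cubic_value_generators image_subset_iff pt_curve)
  ultimately show "M \<in> (topspace (sym_product n m curve) - degenerate) \<inter> incident" by blast
next
  fix M assume M: "M \<in> (topspace (sym_product n m curve) - degenerate) \<inter> incident"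
  then have "M \<in> incident" by blast
  then obtain xs where xs: "M = mset xs" "length xs = m" "set xs \<subseteq> curve"
    and inc: "\<forall>P\<in>set xs. \<forall>Q\<in>set xs.
      cubic_value g0 P * cubic_value g1 Q = cubic_value g0 Q * cubic_value g1 P"
    unfolding incident_def by (elim imageE CollectE conjE)
  have nd: "infinity \<notin> set xs" "distinct xs"
    using M xs unfolding degenerate_def by blast+
  then obtain ys where ys: "xs = map pt ys" using map_pt_of_curve_list xs(3) by blast
  have dist: "distinct ys" using nd ys by (simp add: distinct_map)
  have card: "card (set ys) = m" using dist ys xs(2) by (simp add: distinct_card)
  obtain t where t: "t \<in> good" "set ys = fibre t"
    using inc by (rule_tac fibre_characterization[OF card]) (auto simp: ys cubic_value_generators)
  then have "M = point t" using mset_map_pt[OF dist] xs(1) ys by simp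
  then show "M \<in> point ` good" using t(1) by blast
qed

text \<open>In the chart every monomial becomes a product of polynomials in single coordinates
  \<open>x i\<close>.\<close>

lemma has_polynomial_trace_poly_eval:
  assumes "p \<in> multiforms n m"
  shows "has_polynomial_trace (\<lambda>x. poly_eval (\<lambda>(i, j). chart (x i) $ j) p)"
proof -
  obtain d where d: "p \<in> multidegree_forms n m d" using assms multiforms_iff by blast
  have "has_polynomial_trace (\<lambda>x. \<Sum>\<mu>\<in>Poly_Mapping.keys p. Poly_Mapping.lookup p \<mu> *
      (\<Prod>v\<in>Poly_Mapping.keys \<mu>. poly (q (snd v) ^ Poly_Mapping.lookup \<mu> v) (x (fst v))))"
  proof (intro has_polynomial_trace_sum has_polynomial_trace_cmult has_polynomial_trace_prod_poly)
    fix \<mu> v assume "\<mu> \<in> Poly_Mapping.keys p" "v \<in> Poly_Mapping.keys \<mu>"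
    then show "fst v < m" using d unfolding multidegree_forms_def by fastforce
  qed simp
  moreover have "(\<Sum>\<mu>\<in>Poly_Mapping.keys p. Poly_Mapping.lookup p \<mu> *
      (\<Prod>v\<in>Poly_Mapping.keys \<mu>. poly (q (snd v) ^ Poly_Mapping.lookup \<mu> v) (x (fst v)))) =
      poly_eval (\<lambda>(i, j). chart (x i) $ j) p" for x
    unfolding poly_eval_def
  proof (intro sum.cong prod.cong refl arg_cong2[where f = "(*)"])
    fix \<mu> v assume "\<mu> \<in> Poly_Mapping.keys p" "v \<in> Poly_Mapping.keys \<mu>"
    then have "snd v \<le> n" using d unfolding multidegree_forms_def by fastforce
    then show "poly (q (snd v) ^ Poly_Mapping.lookup \<mu> v) (x (fst v)) =
        (case v of (i, j) \<Rightarrow> chart (x i) $ j) ^ Poly_Mapping.lookup \<mu> v"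
      by (simp add: case_prod_unfold)
  qed
  ultimately show ?thesis by simp
qed

lemma vanishes_at_map_pt:
  assumes p: "p \<in> multiforms n m" and ys: "length ys = m" and x: "\<And>i. i < m \<Longrightarrow> x i = ys ! i"
  shows "vanishes_at n p (map pt ys) \<longleftrightarrow> poly_eval (\<lambda>(i, j). chart (x i) $ j) p = 0"
proof -
  have "map pt ys \<in> proj_tuples n m" using ys pt_in_proj_space by (auto simp: proj_tuples_def)
  moreover have "chart (x i) \<in> map pt ys ! i - {0\<^sub>v (n + 1)}" if "i < m" for i
    using that ys x chart_nonzero self_in_proj_point by (auto simp: pt_def)
  ultimately show ?thesis by (rule vanishes_at_iff[OF p])
qed

text \<open>Each form cutting out \<open>Z\<close> vanishes at all orderings of infinitely many
  fibres. By \<open>trace_vanishing_distinct\<close> it then vanishes at an ordering of every good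
  fibre.\<close>

lemma closed_dichotomy:
  assumes Z: "closedin (sym_product n m curve) Z" and inf: "infinite {t \<in> good. point t \<in> Z}"
  shows "point ` good \<subseteq> Z"
proof
  fix M assume "M \<in> point ` good"
  then obtain t where t: "t \<in> good" and M: "M = point t" by blast
  obtain S where S: "S \<subseteq> multiforms n m" and ZS: "\<And>xs. length xs = m \<Longrightarrow> set xs \<subseteq> curve \<Longrightarrow>
      mset xs \<in> Z \<longleftrightarrow> (\<forall>p\<in>S. vanishes_at n p xs)"
    using Z unfolding closedin_sym_product_iff[OF curve_subset] by blast
  obtain ys where ys: "distinct ys" "set ys = fibre t" "length ys = m" using fibre_list[OF t] .
  \<comment> \<open>The restriction is what membership in the extensional product
    \<open>fibre_tuples t\<close> demands.\<close>
  define y where "y = restrict (\<lambda>i. ys ! i) {..<m}"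
  have y: "y \<in> fibre_tuples t" "inj_on y {..<m}"
    using ys inj_on_nth[of ys "{..<m}"] nth_mem[of _ ys]
    by (simp_all add: y_def inj_on_def PiE_iff)
  have "vanishes_at n p (map pt ys)" if "p \<in> S" for p
  proof -
    have p: "p \<in> multiforms n m" using that S by blast
    define f where "f x = poly_eval (\<lambda>(i, j). chart (x i) $ j) p" for x
    have f: "has_polynomial_trace f"
      unfolding f_def by (rule has_polynomial_trace_poly_eval[OF p])
    have van: "f x = 0"
      if s: "s \<in> {t \<in> good. point t \<in> Z}" and x: "x \<in> fibre_tuples s" "inj_on x {..<m}" for s x
    proof -
      \<comment> \<open>An injective tuple of \<open>m\<close> points of \<open>fibre s\<close>
        lists the whole fibre.\<close>
      define zs where "zs = map x [0..<m]"
      have "set zs \<subseteq> fibre s" using PiE_mem[OF x(1)] by (auto simp: zs_def)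
      moreover have dzs: "distinct zs" using x(2) by (simp add: zs_def distinct_map atLeast0LessThan)
      then have "card (set zs) = length zs" by (rule distinct_card)
      then have "card (set zs) = card (fibre s)" using s by (simp only: zs_def) (simp add: good_def)
      ultimately have "set zs = fibre s" by (simp add: card_subset_eq finite_fibre)
      then have "mset (map pt zs) \<in> Z" using mset_map_pt[OF dzs] s by simp
      moreover have len: "length (map pt zs) = m" by (simp add: zs_def)
      ultimately have "vanishes_at n p (map pt zs)"
        using ZS[OF len map_pt_curve] \<open>p \<in> S\<close> by blast
      moreover have "vanishes_at n p (map pt zs) \<longleftrightarrow> f x = 0"
        unfolding f_def by (rule vanishes_at_map_pt[OF p]) (simp_all add: zs_def)
      ultimately show ?thesis by blast
    qed
    have sub: "{t \<in> good. point t \<in> Z} \<subseteq> good" by blast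
    have "f y = 0"
      by (rule trace_vanishing_distinct[of f "{t \<in> good. point t \<in> Z}", OF f inf sub _ t y]) (rule van)
    moreover have "vanishes_at n p (map pt ys) \<longleftrightarrow> f y = 0"
      unfolding f_def by (rule vanishes_at_map_pt[OF p ys(3)]) (simp add: y_def)
    ultimately show ?thesis by blast
  qed
  moreover have len: "length (map pt ys) = m" using ys(3) by simp
  ultimately have "mset (map pt ys) \<in> Z" using ZS[OF len map_pt_curve] by blast
  then show "M \<in> Z" using M mset_map_pt[OF ys(1,2)] by simp
qed

lemma point_subset_topspace: "point ` good \<subseteq> topspace (sym_product n m curve)"
  using family_eq by blast

text \<open>The closed condition is that \<open>g0\<close> vanishes at all points. For a member it
  says \<open>fibre t \<subseteq> fibre 0\<close>, which forces \<open>t = 0\<close>.\<close>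

lemma closedin_family_point:
  "closedin (subtopology (sym_product n m curve) (point ` good)) {point 0}"
proof -
  define Z where "Z = mset ` {xs. length xs = m \<and> set xs \<subseteq> curve \<and> (\<forall>P\<in>set xs. cubic_value g0 P = 0)}"
  have mf: "cubic_form i g0 \<in> multiforms n m" if "i < m" for i
    using cubic_form_multidegree[OF that] multiforms_iff by blast
  have "closedin (sym_product n m curve) Z"
    unfolding Z_def
  proof (rule closedin_sym_productI[OF curve_subset, of "(\<lambda>i. cubic_form i g0) ` {..<m}"])
    fix xs assume xs: "length xs = m" "set xs \<subseteq> curve"
    then show "(\<forall>P\<in>set xs. cubic_value g0 P = 0) \<longleftrightarrow>
        (\<forall>p\<in>(\<lambda>i. cubic_form i g0) ` {..<m}. vanishes_at n p xs)"
      by (auto simp: all_set_conv_all_nth vanishes_at_rep[OF mf xs] poly_eval_cubic_form)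
  qed (use mf in \<open>auto dest: mset_eq_setD\<close>)
  moreover have "{point 0} = Z \<inter> point ` good"
  proof (intro equalityI subsetI)
    fix M assume "M \<in> {point 0}"
    moreover obtain ys where ys: "distinct ys" "set ys = fibre 0" "length ys = m"
      using fibre_list[OF zero_good] .
    ultimately have M: "M = mset (map pt ys)" using mset_map_pt by simp
    have "M \<in> Z"
      unfolding Z_def M using ys(2,3)
      by (intro imageI CollectI conjI)
         (simp_all add: cubic_value_generators image_subset_iff pt_curve fibre_zero)
    then show "M \<in> Z \<inter> point ` good" using \<open>M \<in> {point 0}\<close> zero_good by blast
  next
    fix M assume "M \<in> Z \<inter> point ` good"
    then obtain t where t: "t \<in> good" "M = point t" "point t \<in> Z" by blast
    then obtain xs where xs: "point t = mset xs" "\<forall>P\<in>set xs. cubic_value g0 P = 0"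
      unfolding Z_def by blast
    have "set_mset (point t) = pt ` fibre t" using finite_fibre by simp
    then have "set xs = pt ` fibre t" using xs(1) by simp
    then have "fibre t \<subseteq> fibre 0"
      using xs(2) by (auto simp: cubic_value_generators fibre_zero)
    then show "M \<in> {point 0}" using fibre_subset_imp_eq t by blast
  qed
  ultimately show ?thesis unfolding closedin_subtopology by blast
qed

theorem family_positive_dimensional: "positive_dimensional_family n m curve family"
proof -
  let ?X = "sym_product n m curve"
  have img: "mset_set ` family = point ` good" by (auto simp: family_def)
  have irr: "irreducible_space (subtopology ?X (point ` good))"
    by (rule irreducible_space_image[OF infinite_good point_subset_topspace closed_dichotomy])
  have "locally_closed_in ?X (point ` good)"
    unfolding locally_closed_in_def
    using family_eq closedin_incident closedin_degenerate openin_closedin_eq by blast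
  moreover have "topspace (subtopology ?X (point ` good)) \<noteq> {point 0}"
  proof
    have top: "topspace (subtopology ?X (point ` good)) = point ` good"
      using point_subset_topspace by auto
    assume "topspace (subtopology ?X (point ` good)) = {point 0}"
    then have *: "point t = point 0" if "t \<in> good" for t
      using that unfolding top by blast
    have "good \<subseteq> {0}"
    proof
      fix t assume "t \<in> good"
      from *[OF this] have "set_mset (point t) = set_mset (point 0)" by simp
      then have "pt ` fibre t = pt ` fibre 0" using finite_fibre by simp
      then have "fibre t = fibre 0" using inj_pt by (simp add: inj_image_eq_iff)
      then show "t \<in> {0}" using fibre_subset_imp_eq[OF \<open>t \<in> good\<close>] by simp
    qed
    then show False using infinite_good finite_subset by blast
  qed
  then have "krull_dim (subtopology ?X (point ` good)) \<ge> 1"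
    by (rule krull_dim_ge_1[OF irr closedin_family_point])
  moreover have "finite B \<and> B \<subseteq> curve \<and> card B = m" if "B \<in> family" for B
    using that finite_fibre card_pt_image by (auto simp: family_def good_def curve_def)
  ultimately show ?thesis
    unfolding positive_dimensional_family_def img using irr by blast
qed

end

section \<open>Sums of fourth powers\<close>

lemma linear_form_smult: "linear_form (c \<cdot>\<^sub>v v) = scale_poly c (linear_form v)"
  unfolding linear_form_def cpoly.scale_sum_right
  by (intro sum.cong) (simp_all add: scale_poly_def mult_single)

lemma scale_poly_mult: "scale_poly a p * scale_poly b r = scale_poly (a * b) (p * r)"
proof -
  have "scale_poly a p * scale_poly b r =
      (Poly_Mapping.single 0 a * Poly_Mapping.single 0 b) * (p * r)"
    by (simp only: scale_poly_def mult_ac)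
  then show ?thesis by (simp add: scale_poly_def mult_single)
qed

lemma scale_poly_power: "scale_poly c p ^ k = scale_poly (c ^ k) (p ^ k)"
  by (induction k) (simp_all add: scale_poly_mult)

lemma span_image_finite:
  assumes "finite X" "T \<in> cpoly.span (f ` X)"
  shows "\<exists>c. T = (\<Sum>x\<in>X. scale_poly (c x) (f x))"
  using assms
proof (induction X arbitrary: T)
  case (insert x X)
  then obtain k where "T - scale_poly k (f x) \<in> cpoly.span (f ` X)"
    by (auto simp: cpoly.span_breakdown_eq)
  with insert.IH obtain c where c: "T - scale_poly k (f x) = (\<Sum>y\<in>X. scale_poly (c y) (f y))"
    by blast
  have "(\<Sum>y\<in>X. scale_poly ((c(x := k)) y) (f y)) = (\<Sum>y\<in>X. scale_poly (c y) (f y))"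
    using insert.hyps by (intro sum.cong) auto
  then have "T = (\<Sum>y\<in>insert x X. scale_poly ((c(x := k)) y) (f y))"
    using c insert.hyps by (simp add: algebra_simps)
  then show ?case by blast
qed simp

context rational_chart
begin

definition chart_power :: "complex \<Rightarrow> nat cpoly" where
  "chart_power x = linear_form (chart x) ^ 4"

text \<open>The line \<open>veronese 4 (pt x)\<close> is spanned by \<open>chart_power x\<close>,
  since replacing the representative by \<open>b\<close> times it only multiplies the fourth power
  by \<open>b ^ 4\<close>.\<close>

lemma computes_iff:
  assumes "finite X"
  shows "computes n T (pt ` X) \<longleftrightarrow> (\<exists>c. T = (\<Sum>x\<in>X. scale_poly (c x) (chart_power x)))"
proof
  assume "computes n T (pt ` X)"
  then have T: "T \<in> cpoly.span (\<Union>P\<in>pt ` X. veronese 4 P)" by (simp add: computes_def)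
  have "(\<Union>P\<in>pt ` X. veronese 4 P) \<subseteq> cpoly.span (chart_power ` X)"
  proof
    fix p assume "p \<in> (\<Union>P\<in>pt ` X. veronese 4 P)"
    then obtain x c v where x: "x \<in> X" and v: "v \<in> pt x" and p: "p = scale_poly c (linear_form v ^ 4)"
      by (auto simp: veronese_def)
    from v obtain b where "v = b \<cdot>\<^sub>v chart x" by (auto simp: pt_def proj_point_def)
    then have "p = scale_poly (c * b ^ 4) (chart_power x)"
      by (simp add: p linear_form_smult scale_poly_power chart_power_def)
    then show "p \<in> cpoly.span (chart_power ` X)"
      using x by (auto intro: cpoly.span_scale cpoly.span_base)
  qed
  then have "T \<in> cpoly.span (chart_power ` X)"
    using T cpoly.span_minimal[OF _ cpoly.subspace_span] by blast
  then show "\<exists>c. T = (\<Sum>x\<in>X. scale_poly (c x) (chart_power x))"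
    by (rule span_image_finite[OF assms])
next
  assume "\<exists>c. T = (\<Sum>x\<in>X. scale_poly (c x) (chart_power x))"
  then obtain c where T: "T = (\<Sum>x\<in>X. scale_poly (c x) (chart_power x))" by blast
  have mem: "scale_poly (c x) (chart_power x) \<in> veronese 4 (pt x)" for x
    using self_in_proj_point[of "chart x"] by (auto simp: veronese_def chart_power_def pt_def)
  have "T \<in> cpoly.span (\<Union>P\<in>pt ` X. veronese 4 P)"
    unfolding T
  proof (rule cpoly.span_sum)
    fix x assume "x \<in> X"
    then show "scale_poly (c x) (chart_power x) \<in> cpoly.span (\<Union>P\<in>pt ` X. veronese 4 P)"
      using mem[of x] by (intro cpoly.span_base) blast
  qed
  then show "computes n T (pt ` X)"
    using assms pt_in_proj_space by (auto simp: computes_def)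
qed

abbreviation coordinate :: "nat \<Rightarrow> nat cpoly" where
  "coordinate j \<equiv> Poly_Mapping.single (Poly_Mapping.single j 1) 1"

lemma chart_power_expansion:
  "chart_power x = (\<Sum>i\<le>n. \<Sum>j\<le>n. \<Sum>k\<le>n. \<Sum>h\<le>n. scale_poly (poly (q h * q k * (q j * q i)) x)
     (coordinate h * coordinate k * (coordinate j * coordinate i)))"
proof -
  have "linear_form (chart x) = (\<Sum>j\<le>n. scale_poly (poly (q j) x) (coordinate j))"
    unfolding linear_form_def
    by (intro sum.cong) (auto simp: chart_def scale_poly_def mult_single)
  then show ?thesis
    unfolding chart_power_def power4_eq_xxxx mult.assoc[of "_ * _"]
    by (simp only: sum_product scale_poly_mult poly_mult sum_distrib_left sum_distrib_right)
qed

text \<open>By \<open>chart_power_expansion\<close>, such a sum depends only on the values of the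
  weighted evaluation functional at products of four \<open>q j\<close>, and these have degree at
  most \<open>4 * n\<close>.\<close>

lemma sum_chart_power_eq:
  assumes "\<And>p. degree p \<le> 4 * n \<Longrightarrow> (\<Sum>x\<in>X. c x * poly p x) = (\<Sum>y\<in>Y. d y * poly p y)"
  shows "(\<Sum>x\<in>X. scale_poly (c x) (chart_power x)) = (\<Sum>y\<in>Y. scale_poly (d y) (chart_power y))"
proof -
  have ex: "(\<Sum>x\<in>Z. scale_poly (f x) (chart_power x)) =
      (\<Sum>i\<le>n. \<Sum>j\<le>n. \<Sum>k\<le>n. \<Sum>h\<le>n. scale_poly (\<Sum>x\<in>Z. f x * poly (q h * q k * (q j * q i)) x)
         (coordinate h * coordinate k * (coordinate j * coordinate i)))" for Z f
  proof -
    have "(\<Sum>x\<in>Z. scale_poly (f x) (chart_power x)) = (\<Sum>x\<in>Z. \<Sum>i\<le>n. \<Sum>j\<le>n. \<Sum>k\<le>n. \<Sum>h\<le>n.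
        scale_poly (f x * poly (q h * q k * (q j * q i)) x)
          (coordinate h * coordinate k * (coordinate j * coordinate i)))"
      unfolding chart_power_expansion
      by (simp only: cpoly.scale_sum_right cpoly.scale_scale)
    also have "\<dots> = (\<Sum>i\<le>n. \<Sum>j\<le>n. \<Sum>k\<le>n. \<Sum>h\<le>n. \<Sum>x\<in>Z.
        scale_poly (f x * poly (q h * q k * (q j * q i)) x)
          (coordinate h * coordinate k * (coordinate j * coordinate i)))"
      by (simp only: sum.swap[where A = Z])
    finally show ?thesis by (simp only: cpoly.scale_sum_left)
  qed
  have deg: "degree (q h * q k * (q j * q i)) \<le> 4 * n" if "h \<le> n" "k \<le> n" "j \<le> n" "i \<le> n" for h k j i
  proof -
    have "degree (q h * q k * (q j * q i)) \<le> (n + n) + (n + n)"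
      using that by (intro order_trans[OF degree_mult_le] add_mono degree_q)
    then show ?thesis by simp
  qed
  show ?thesis
    unfolding ex
    by (intro sum.cong refl arg_cong2[where f = scale_poly] assms deg) simp_all
qed

end

text \<open>The functional \<open>p \<mapsto> (\<Sum>x\<in>X. c x * poly p x)\<close> annihilates the multiples \<open>member t * h\<close> with
  \<open>degree h < m - 1\<close>: on \<open>X\<close> the polynomial \<open>g0\<close> vanishes and \<open>g1\<close> turns the weights \<open>c\<close> into the
  Lagrange weights, whose functional reads off the coefficient of degree \<open>m - 1\<close>.\<close>

lemma (in polynomial_pencil) sum_over_fibre:
  assumes X: "X = fibre 0" and c: "\<And>x. x \<in> X \<Longrightarrow> c x * poly g1 x = lagrange_weight X x"
    and t: "t \<in> good" and p: "degree p \<le> 2 * m - 2"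
  shows "(\<Sum>x\<in>X. c x * poly p x) =
    (\<Sum>r\<in>fibre t. (\<Sum>x\<in>X. c x * poly (lagrange_basis (fibre t) r) x) * poly p r)"
proof -
  define h where "h = p div member t"
  define s where "s = p mod member t"
  have p_eq: "p = member t * h + s" by (simp add: h_def s_def)
  have deg_s: "degree s < m"
    using degree_mod_less[OF member_nonzero[of t], of p] m_pos by (auto simp: s_def degree_member)
  have cardX: "card X = m" using zero_good X by (simp add: good_def)
  have finX: "finite X" using finite_fibre X by simp
  \<comment> \<open>The bound \<open>2 * m - 2\<close> on \<open>degree p\<close> keeps
    \<open>h\<close> strictly below the degree whose coefficient the Lagrange weights read
    off.\<close>
  have deg_h: "h = 0 \<or> degree h < m - 1"
  proof (cases "h = 0")
    case False
    have "m + degree h = degree (p - s)"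
      using False member_nonzero[of t] by (simp add: p_eq degree_mult_eq degree_member)
    also have "\<dots> \<le> 2 * m - 2"
      using p deg_s by (intro degree_diff_le) auto
    finally show ?thesis using m_pos by linarith
  qed simp
  have "(\<Sum>x\<in>X. c x * poly (member t * h) x) = t * (\<Sum>x\<in>X. poly h x * lagrange_weight X x)"
    unfolding sum_distrib_left
  proof (intro sum.cong refl)
    fix x assume x: "x \<in> X"
    then have "poly g0 x = 0" using X by (simp add: fibre_zero)
    then show "c x * poly (member t * h) x = t * (poly h x * lagrange_weight X x)"
      by (simp add: member_def c[OF x, symmetric])
  qed
  also have "\<dots> = t * coeff h (m - 1)"
  proof -
    have "degree h < card X" using deg_h m_pos unfolding cardX by auto
    then show ?thesis using sum_lagrange_weight[OF finX] by (simp only: cardX)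
  qed
  also have "\<dots> = 0" using deg_h by (auto simp: coeff_eq_0)
  finally have "(\<Sum>x\<in>X. c x * poly p x) = (\<Sum>x\<in>X. c x * poly s x)"
    by (simp add: p_eq distrib_left sum.distrib)
  \<comment> \<open>The remainder is interpolated on the fibre, where it agrees with
    \<open>p\<close>.\<close>
  also have "s = (\<Sum>r\<in>fibre t. smult (poly p r) (lagrange_basis (fibre t) r))"
  proof -
    have "s = (\<Sum>r\<in>fibre t. smult (poly s r) (lagrange_basis (fibre t) r))"
      using t deg_s by (intro lagrange_interpolation finite_fibre) (simp add: good_def)
    also have "\<dots> = (\<Sum>r\<in>fibre t. smult (poly p r) (lagrange_basis (fibre t) r))"
      by (intro sum.cong) (simp_all add: p_eq fibre_def)
    finally show ?thesis .
  qed
  also have "(\<Sum>x\<in>X. c x * poly (\<Sum>r\<in>fibre t. smult (poly p r) (lagrange_basis (fibre t) r)) x) =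
      (\<Sum>x\<in>X. \<Sum>r\<in>fibre t. c x * (poly p r * poly (lagrange_basis (fibre t) r) x))"
    by (simp add: poly_sum sum_distrib_left)
  also have "\<dots> = (\<Sum>r\<in>fibre t. (\<Sum>x\<in>X. c x * poly (lagrange_basis (fibre t) r) x) * poly p r)"
    by (subst sum.swap) (simp add: sum_distrib_left mult_ac)
  finally show ?thesis .
qed

section \<open>Constructing a chart with prescribed points away from infinity\<close>

lemma mult_mat_proj_point:
  assumes "M \<in> carrier_mat k l" "v \<in> carrier_vec l"
  shows "(\<lambda>u. M *\<^sub>v u) ` proj_point v = proj_point (M *\<^sub>v v)"
proof -
  have "M *\<^sub>v (c \<cdot>\<^sub>v v) = c \<cdot>\<^sub>v (M *\<^sub>v v)" for c
    using assms by (rule mult_mat_vec)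
  then show ?thesis by (auto simp: proj_point_def image_iff) metis+
qed

lemma proj_point_smult:
  assumes "c \<noteq> 0" shows "proj_point (c \<cdot>\<^sub>v v) = proj_point v"
proof -
  have "a \<cdot>\<^sub>v v = (a / c) \<cdot>\<^sub>v (c \<cdot>\<^sub>v v)" for a using assms by (simp add: smult_smult_assoc)
  moreover have "a \<cdot>\<^sub>v (c \<cdot>\<^sub>v v) = (a * c) \<cdot>\<^sub>v v" for a by (simp add: smult_smult_assoc)
  ultimately show ?thesis unfolding proj_point_def by blast
qed

text \<open>The chart is \<open>x \<mapsto> [1 + b * x : x]\<close>, whose point at infinity \<open>[b : 1]\<close> is moved off \<open>A\<close>.\<close>

lemma rational_normal_curve_chart:
  assumes n: "1 \<le> n" and \<Gamma>: "rational_normal_curve n \<Gamma>" and A: "finite A"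
  obtains q l w where "rational_chart n q l w" "rational_chart.curve n q w = \<Gamma>"
    "rational_chart.infinity w \<notin> A"
proof -
  obtain M where M: "M \<in> carrier_mat (n + 1) (n + 1)" and inv: "invertible_mat M"
    and \<Gamma>_eq: "\<Gamma> = (\<lambda>P. (\<lambda>v. M *\<^sub>v v) ` P) ` standard_rational_normal_curve n"
    using \<Gamma> unfolding rational_normal_curve_def by blast
  obtain N where MN: "M * N = 1\<^sub>m (dim_row M)" and NM: "N * M = 1\<^sub>m (dim_row N)"
    using inv unfolding invertible_mat_def inverts_mat_def by blast
  have N: "N \<in> carrier_mat (n + 1) (n + 1)"
    using arg_cong[OF MN, of dim_col] arg_cong[OF NM, of dim_col] M by (intro carrier_matI) auto
  define u where "u s t = vec (n + 1) (\<lambda>i. s ^ (n - i) * t ^ i)" for s t :: complex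
  have u [simp]: "u s t \<in> carrier_vec (n + 1)" for s t by (simp add: u_def)
  define v where "v s t = M *\<^sub>v u s t" for s t
  have v [simp]: "v s t \<in> carrier_vec (n + 1)" for s t
    unfolding v_def using M u by (rule mult_mat_vec_carrier)
  have Nv: "N *\<^sub>v v s t = u s t" for s t
  proof -
    have "N *\<^sub>v v s t = (N * M) *\<^sub>v u s t"
      unfolding v_def by (rule assoc_mult_mat_vec[OF N M u, symmetric])
    also have "N * M = 1\<^sub>m (n + 1)" using NM carrier_matD(1)[OF N] by (simp only:)
    also have "\<dots> *\<^sub>v u s t = u s t" by (rule one_mult_mat_vec[OF u])
    finally show ?thesis .
  qed
  have Nv_index: "(\<Sum>j\<le>n. N $$ (i, j) * v s t $ j) = s ^ (n - i) * t ^ i" if "i \<le> n" for i s t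
  proof -
    have "s ^ (n - i) * t ^ i = (N *\<^sub>v v s t) $ i" using that unfolding Nv by (simp add: u_def)
    also have "\<dots> = row N i \<bullet> v s t" using N that by simp
    also have "\<dots> = (\<Sum>j\<in>{0..<n + 1}. N $$ (i, j) * v s t $ j)"
      unfolding scalar_prod_def using N that carrier_vecD[OF v[of s t]] by (intro sum.cong) auto
    also have "{0..<n + 1} = {..n}" by auto
    finally show ?thesis by simp
  qed
  have \<Gamma>_iff: "P \<in> \<Gamma> \<longleftrightarrow> (\<exists>s t. (s, t) \<noteq> (0, 0) \<and> P = proj_point (v s t))" for P
    unfolding \<Gamma>_eq standard_rational_normal_curve_def v_def
    using mult_mat_proj_point[OF M u] by (auto simp: u_def image_iff) metis+
  \<comment> \<open>Infinitely many candidates for the point at infinity leave one outside the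
    finite set \<open>A\<close>.\<close>
  have "inj (\<lambda>b. proj_point (v b 1))"
  proof
    fix b b' assume "proj_point (v b 1) = proj_point (v b' 1)"
    then have "v b 1 \<in> proj_point (v b' 1)" using self_in_proj_point[of "v b 1"] by simp
    then obtain c where c: "v b 1 = c \<cdot>\<^sub>v v b' 1" by (auto simp: proj_point_def)
    have eq: "b ^ (n - i) = c * b' ^ (n - i)" if "i \<le> n" for i
    proof -
      have "b ^ (n - i) = (\<Sum>j\<le>n. N $$ (i, j) * (c \<cdot>\<^sub>v v b' 1) $ j)"
        using Nv_index[OF that, of b 1] c by simp
      also have "\<dots> = c * (\<Sum>j\<le>n. N $$ (i, j) * v b' 1 $ j)"
        unfolding sum_distrib_left using carrier_vecD[OF v[of b' 1]] by (intro sum.cong) auto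
      finally show ?thesis using Nv_index[OF that, of b' 1] by simp
    qed
    from eq[of n] have "c = 1" by simp
    with eq[of "n - 1"] n show "b = b'" by simp
  qed
  then have "infinite (range (\<lambda>b. proj_point (v b 1)))"
    using infinite_UNIV_char_0 finite_imageD by blast
  then obtain b where b: "proj_point (v b 1) \<notin> A"
    using A finite_subset[of "range (\<lambda>b. proj_point (v b 1))" A] by blast
  \<comment> \<open>By the binomial theorem this combination of rows of the inverse matrix
    \<open>N\<close> takes the value \<open>t ^ a * (s - b * t) ^ (n - a)\<close> at
    \<open>v s t\<close>. On the chart \<open>s - b * t = 1\<close> and \<open>t = x\<close>,
    leaving \<open>x ^ a\<close>.\<close>
  define l where "l a j = (\<Sum>k\<le>n - a. of_nat (n - a choose k) * (- b) ^ k * N $$ (a + k, j))" for a j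
  have l: "(\<Sum>j\<le>n. l a j * v s t $ j) = t ^ a * (s - b * t) ^ (n - a)" if "a \<le> n" for a s t
  proof -
    have "(\<Sum>j\<le>n. l a j * v s t $ j) = (\<Sum>k\<le>n - a. of_nat (n - a choose k) * (- b) ^ k *
        (\<Sum>j\<le>n. N $$ (a + k, j) * v s t $ j))"
      unfolding l_def sum_distrib_right sum_distrib_left
      by (subst sum.swap) (simp add: mult_ac)
    also have "\<dots> = (\<Sum>k\<le>n - a. t ^ a * (of_nat (n - a choose k) * (- b * t) ^ k * s ^ (n - a - k)))"
    proof (intro sum.cong refl)
      fix k assume "k \<in> {..n - a}"
      then have "a + k \<le> n" using that by simp
      from Nv_index[OF this] show "of_nat (n - a choose k) * (- b) ^ k *
          (\<Sum>j\<le>n. N $$ (a + k, j) * v s t $ j) =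
          t ^ a * (of_nat (n - a choose k) * (- b * t) ^ k * s ^ (n - a - k))"
        by (simp only: power_add power_mult_distrib diff_diff_left mult_ac)
    qed
    also have "\<dots> = t ^ a * (- b * t + s) ^ (n - a)"
      by (simp only: binomial_ring sum_distrib_left)
    finally show ?thesis by simp
  qed
  define q where "q j = (\<Sum>i\<le>n. smult (M $$ (j, i)) ([:1, b:] ^ (n - i) * [:0, 1:] ^ i))" for j
  have q: "poly (q j) x = v (1 + b * x) x $ j" if "j \<le> n" for j x
  proof -
    have "v (1 + b * x) x $ j = row M j \<bullet> u (1 + b * x) x"
      using M that by (simp add: v_def)
    also have "\<dots> = (\<Sum>i\<in>{0..<n + 1}. M $$ (j, i) * ((1 + b * x) ^ (n - i) * x ^ i))"
      unfolding scalar_prod_def using M that by (intro sum.cong) (auto simp: u_def)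
    also have "{0..<n + 1} = {..n}" by auto
    finally show ?thesis by (simp add: q_def poly_sum mult_ac)
  qed
  have chart: "vec (n + 1) (\<lambda>j. poly (q j) x) = v (1 + b * x) x" for x
    using carrier_vecD[OF v[of "1 + b * x" x]] by (intro eq_vecI) (auto simp: q)
  interpret rational_chart n q l "v b 1"
  proof
    show "1 \<le> n" by (rule n)
    show "degree (q j) \<le> n" for j
      unfolding q_def
    proof (intro degree_sum_le order_trans[OF degree_smult_le])
      fix i assume "i \<in> {..n}"
      have "degree ([:1, b:] ^ (n - i) * [:0, 1:] ^ i) \<le> (n - i) * 1 + i * 1"
        by (intro order_trans[OF degree_mult_le] add_mono order_trans[OF degree_power_le])
           (auto simp: mult.commute)
      then show "degree ([:1, b:] ^ (n - i) * [:0, 1:] ^ i) \<le> n" using \<open>i \<in> {..n}\<close> by simp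
    qed simp
    show "(\<Sum>j\<le>n. l a j * poly (q j) x) = x ^ a" if "a \<le> n" for a x
      using l[OF that, of "1 + b * x" x] by (simp add: q)
    show "v b 1 \<in> carrier_vec (n + 1)" by (rule v)
    show "v b 1 \<noteq> 0\<^sub>v (n + 1)"
    proof
      assume "v b 1 = 0\<^sub>v (n + 1)"
      then have "(\<Sum>j\<le>n. l n j * v b 1 $ j) = 0" by simp
      then show False using l[of n b 1] by simp
    qed
    show "(\<Sum>j\<le>n. l 0 j * v b 1 $ j) = 0" using l[of 0 b 1] n by simp
  qed
  have pt_eq: "pt x = proj_point (v (1 + b * x) x)" for x
    unfolding pt_def chart_def chart ..
  have v_smult: "v (c * s) (c * t) = c ^ n \<cdot>\<^sub>v v s t" for c s t
  proof -
    have "u (c * s) (c * t) = c ^ n \<cdot>\<^sub>v u s t"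
    proof (intro eq_vecI)
      fix i assume "i < dim_vec (c ^ n \<cdot>\<^sub>v u s t)"
      then have i: "i \<le> n" by (simp add: u_def)
      then have "c ^ n = c ^ (n - i) * c ^ i" by (simp flip: power_add)
      then show "u (c * s) (c * t) $ i = (c ^ n \<cdot>\<^sub>v u s t) $ i"
        using i by (simp add: u_def power_mult_distrib)
    qed (simp add: u_def)
    then show ?thesis unfolding v_def using mult_mat_vec[OF M u] by simp
  qed
  have "curve = \<Gamma>"
  proof (intro equalityI subsetI)
    fix P assume "P \<in> curve"
    then consider "P = proj_point (v b 1)" | x where "P = proj_point (v (1 + b * x) x)"
      by (auto simp: curve_def infinity_def pt_eq)
    then show "P \<in> \<Gamma>"
    proof cases
      case 1
      then show ?thesis unfolding \<Gamma>_iff by (intro exI[of _ b] exI[of _ 1]) simp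
    next
      case (2 x)
      then show ?thesis unfolding \<Gamma>_iff by (intro exI[of _ "1 + b * x"] exI[of _ x]) auto
    qed
  next
    fix P assume "P \<in> \<Gamma>"
    then obtain s t where st: "(s, t) \<noteq> (0, 0)" and P: "P = proj_point (v s t)"
      unfolding \<Gamma>_iff by blast
    show "P \<in> curve"
    proof (cases "s = b * t")
      case True
      then have t: "t \<noteq> 0" using st by auto
      have "v s t = t ^ n \<cdot>\<^sub>v v b 1" using v_smult[of t b 1] True by (simp add: mult.commute)
      then show ?thesis
        using t by (simp add: P proj_point_smult curve_def infinity_def)
    next
      case False
      \<comment> \<open>Rescaling \<open>(s, t)\<close> so that \<open>s - b * t\<close> becomes 1
        brings the point into the chart.\<close>
      define x where "x = t / (s - b * t)"
      have "s = (s - b * t) * (1 + b * x)" "t = (s - b * t) * x"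
        using False by (simp_all add: x_def field_simps)
      then have "v s t = (s - b * t) ^ n \<cdot>\<^sub>v v (1 + b * x) x"
        using v_smult[of "s - b * t" "1 + b * x" x] by simp
      then have "P = pt x" using False by (simp add: P proj_point_smult pt_eq)
      then show ?thesis by (simp add: curve_def)
    qed
  qed
  moreover have "infinity \<notin> A" using b by (simp add: infinity_def)
  ultimately show thesis using that rational_chart_axioms by blast
qed

theorem proposition6p4:
  fixes n :: nat and T :: "nat cpoly" and A \<Gamma> :: "complex vec set set"
  assumes "n \<ge> 1"
    and "T \<in> forms 4 n" and "T \<noteq> 0"
    and "minimally_computes n T A"
    and "card A = 2 * n + 1"
    and "rational_normal_curve n \<Gamma>" and "A \<subseteq> \<Gamma>"
  shows "\<exists>F. positive_dimensional_family n (2 * n + 1) \<Gamma> F \<and>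
           (\<forall>B\<in>F. card B = 2 * n + 1) \<and>
           A \<in> F \<and>
           (\<forall>B\<in>F. computes n T B)"
proof -
  have comp: "computes n T A" and minimal: "\<And>A'. A' \<subset> A \<Longrightarrow> \<not> computes n T A'"
    using assms(4) by (auto simp: minimally_computes_def)
  have finA: "finite A" using comp by (simp add: computes_def)
  obtain q l w where chart: "rational_chart n q l w" and curve: "rational_chart.curve n q w = \<Gamma>"
    and inf: "rational_chart.infinity w \<notin> A"
    using rational_normal_curve_chart[OF assms(1,6) finA] by blast
  interpret rational_chart n q l w by (rule chart)
  define X where "X = pt -` A"
  have A: "A = pt ` X" using assms(7) inf by (auto simp: X_def curve[symmetric] curve_def)
  have finX: "finite X" unfolding X_def using finA inj_pt by (rule finite_vimageI)
  have cardX: "card X = 2 * n + 1"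
    using assms(5) card_image[OF inj_on_subset[OF inj_pt], of X] by (simp add: A)
  obtain c where T: "T = (\<Sum>x\<in>X. scale_poly (c x) (chart_power x))"
    using comp unfolding A computes_iff[OF finX] by blast
  \<comment> \<open>A zero coefficient would let \<open>A\<close> without that point compute
    \<open>T\<close>, against minimality.\<close>
  have c_nonzero: "c x \<noteq> 0" if x: "x \<in> X" for x
  proof
    assume "c x = 0"
    then have "T = (\<Sum>y\<in>X - {x}. scale_poly (c y) (chart_power y))"
      unfolding T using finX x by (simp add: sum.remove)
    then have "computes n T (pt ` (X - {x}))" using finX computes_iff[of "X - {x}"] by blast
    moreover have "pt ` (X - {x}) \<subset> A"
      using x inj_image_mem_iff[OF inj_pt, of x "X - {x}"] unfolding A by blast
    ultimately show False using minimal by blast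
  qed
  define g0 where "g0 = (\<Prod>x\<in>X. [:- x, 1:])"
  \<comment> \<open>The interpolated values are chosen so that \<open>c x * poly g1 x\<close> is the
    Lagrange weight, as \<open>sum_over_fibre\<close> requires.\<close>
  define g1 where "g1 = (\<Sum>x\<in>X. smult (lagrange_weight X x / c x) (lagrange_basis X x))"
  have g0_roots: "{x. poly g0 x = 0} = X" using finX by (auto simp: g0_def poly_prod)
  have g1: "poly g1 x = lagrange_weight X x / c x" if "x \<in> X" for x
    unfolding g1_def by (rule poly_lagrange_sum[OF finX that])
  interpret chart_pencil n q l w g0 g1 "2 * n + 1"
  proof
    show "degree g0 = 2 * n + 1" by (simp add: g0_def degree_prod_linear cardX)
    show "lead_coeff g0 = 1" unfolding g0_def by (rule lead_coeff_prod_linear)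
    have "X \<noteq> {}" using cardX by auto
    then show "degree g1 < 2 * n + 1"
      unfolding g1_def cardX[symmetric] by (rule degree_lagrange_sum[OF finX])
    show "card {x. poly g0 x = 0} = 2 * n + 1" unfolding g0_roots by (rule cardX)
    show "poly g1 x \<noteq> 0" if "poly g0 x = 0" for x
    proof -
      have "x \<in> X" using that g0_roots by blast
      then show ?thesis using g1 c_nonzero lagrange_weight_nonzero[OF finX] by simp
    qed
    show "2 * n + 1 \<le> 3 * n" using assms(1) by simp
  qed
  have X: "X = fibre 0" using g0_roots fibre_zero by simp
  have "computes n T B" if "B \<in> family" for B
  proof -
    from that obtain t where t: "t \<in> good" and B: "B = pt ` fibre t"
      unfolding family_def by blast
    \<comment> \<open>The new weights are the values of the functional of \<open>T\<close> at the
      Lagrange basis of the new fibre. The degrees match, since \<open>2 * m - 2 = 4 * n\<close> for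
      \<open>m = 2 * n + 1\<close>.\<close>
    define d where "d r = (\<Sum>x\<in>X. c x * poly (lagrange_basis (fibre t) r) x)" for r
    have "T = (\<Sum>r\<in>fibre t. scale_poly (d r) (chart_power r))"
      unfolding T d_def
    proof (intro sum_chart_power_eq sum_over_fibre X t)
      fix x assume "x \<in> X"
      then show "c x * poly g1 x = lagrange_weight X x" using g1 c_nonzero by simp
    qed simp
    then show ?thesis unfolding B computes_iff[OF finite_fibre] by blast
  qed
  moreover have "card B = 2 * n + 1" if "B \<in> family" for B
    using that unfolding family_def good_def by (auto simp: card_pt_image)
  moreover have "A \<in> family" unfolding family_def using A X zero_good by blast
  ultimately show ?thesis
    using family_positive_dimensional unfolding curve by blast
qed

end
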